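(* (Higher Serre relations.) Let $(I,\cdot)$ be a super Cartan datum with a root datum $(Y,X,\langle\,,\rangle)$, let $\mathbf U$ be the associated quantum covering group, and let $i,j\in I$ be distinct. Let $n,m\ge0$. If $m>-n\langle i,j'\rangle$, then $e_{i,j;n,m}=0$ in $\mathbf U$, where $$e_{i,j;n,m}=\sum_{r+s=m}(-1)^r\pi_i^{p(n,r;i,j)}(\pi_iq_i)^{-r(n\langle i,j'\rangle+m-1)}E_i^{(r)}E_j^{(n)}E_i^{(s)},\qquad p(n,r;i,j)=rn\,p(i)p(j)+\binom r2p(i),$$ the sum being over $r,s\ge0$.
   Context: A super Cartan datum is a finite set $I=I_{\bar 0}\sqcup I_{\bar 1}$ with $I_{\bar 1}\ne\emptyset$ and a symmetric $\mathbb Z$-valued bilinear form on $\mathbb Z[I]$ such that $d_i=\frac{i\cdot i}{2}\in\mathbb Z_{>0}$; $2\frac{i\cdot j}{i\cdot i}\in-\mathbb N$ for $i\ne j$; and $2\frac{i\cdot j}{i\cdot i}\in 2\mathbb Z$ for $i\in I_{\bar 1}$, $j\in I$. The parity $p:\mathbb Z[I]\to\mathbb Z$ is the homomorphism with $p(i)=0$ on $I_{\bar 0}$, $p(i)=1$ on $I_{\bar 1}$. A root datum consists of finitely generated free abelian groups $Y,X$, a perfect pairing $\langle\,,\rangle:Y\times X\to\mathbb Z$, and embeddings $I\subset X$ ($i\mapsto i'$), $I\subset Y$ ($i\mapsto i$) with linearly independent images and $\langle i,j'\rangle=\frac{2i\cdot j}{i\cdot i}$. $\mathbb Q(q)^\pi=\mathbb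 Q(q)[\pi]/(\pi^2-1)$; $q_i=q^{d_i}$, $\pi_i=\pi^{p(i)}$. $[n]_i=\frac{(\pi_iq_i)^n-q_i^{-n}}{\pi_iq_i-q_i^{-1}}$, $[n]_i^!=\prod_{s=1}^n[s]_i$. ${}'\mathbf f$ is the free associative unital $\mathbb Q(q)^\pi$-superalgebra on $\theta_i$ $(i\in I)$, with weight grading $|\theta_i|=i$ and parity $p(x)=p(|x|)$. ${}'\mathbf f\otimes{}'\mathbf f$ has multiplication $(x_1\otimes x_2)(x_1'\otimes x_2')=q^{|x_2|\cdot|x_1'|}\pi^{p(x_2)p(x_1')}x_1x_1'\otimes x_2x_2'$, and $r$ is the algebra homomorphism with $r(\theta_i)=\theta_i\otimes1+1\otimes\theta_i$. $(\cdot,\cdot)$ is the unique $\mathbb Q(q)^\pi$-valued bilinear form on ${}'\mathbf f$ with $(1,1)=1$, $(\theta_i,\theta_j)=\delta_{ij}(1-\pi_iq_i^{-2})^{-1}$, $(x,y'y'')=(r(x),y'\otimes y'')$, $(xx',y'')=(x\otimes x',r(y''))$, where $(x_1\otimes x_2,x_1'\otimes x_2')=(x_1,x_1')(x_2,x_2')$. $\mathcal I$ is its radical (a two-sided ideal). $\mathbf U$ is the unital associative $\mathbb Q(q)^\pi$-superalgebra with generators $E_i,F_i$ $(i\in I)$ of parity $p(i)$ and even generators $J_\mu,K_\mu$ $(\mu\in Y)$, and relations: $K_0=1$, $K_\mu K_{\mu'}=K_{\mu+\mu'}$; $J_{2\mu}=1$, $J_\mu J_{\mu'}=J_{\mu+\mu'}$;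 $J_\mu K_{\mu'}=K_{\mu'}J_\mu$; $K_\mu E_i=q^{\langle\mu,i'\rangle}E_iK_\mu$, $J_\mu E_i=\pi^{\langle\mu,i'\rangle}E_iJ_\mu$; $K_\mu F_i=q^{-\langle\mu,i'\rangle}F_iK_\mu$, $J_\mu F_i=\pi^{-\langle\mu,i'\rangle}F_iJ_\mu$; $E_iF_j-\pi^{p(i)p(j)}F_jE_i=\delta_{ij}\frac{\widetilde J_i\widetilde K_i-\widetilde K_{-i}}{\pi_iq_i-q_i^{-1}}$ with $\widetilde K_{\pm i}=K_{\pm d_ii}$, $\widetilde J_i=J_{d_ii}$; and $f(E_i:i\in I)=f(F_i:i\in I)=0$ for every $f(\theta_i:i\in I)\in\mathcal I$. $E_i^{(n)}=E_i^n/[n]_i^!$ for $n\ge0$. *)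

theory Defs
  imports
    "HOL-Library.Poly_Mapping"
    "HOL-Computational_Algebra.Polynomial"
    "HOL-Computational_Algebra.Fraction_Field"
    "HOL-Algebra.Algebraic_Closure_Type"
    "HOL-Algebra.QuotRing"
begin

section \<open>The ground ring $\mathbb Q(q)^\pi = \mathbb Q(q)[\pi]/(\pi^2-1)$\<close>

type_synonym ratfun = "rat poly fract"

quotient_type ratfun_pi = "ratfun poly" / "\<lambda>a b. [:- 1, 0, 1:] dvd a - b"
proof (rule equivpI)
  show "reflp (\<lambda>a b :: ratfun poly. [:- 1, 0, 1:] dvd a - b)"
    by (rule reflpI) simp
  show "symp (\<lambda>a b :: ratfun poly. [:- 1, 0, 1:] dvd a - b)"
    by (rule sympI) (metis dvd_minus_iff minus_diff_eq)
  show "transp (\<lambda>a b :: ratfun poly. [:- 1, 0, 1:] dvd a - b)"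
  proof (rule transpI)
    fix a b c :: "ratfun poly"
    assume "[:- 1, 0, 1:] dvd a - b" "[:- 1, 0, 1:] dvd b - c"
    then have "[:- 1, 0, 1:] dvd (a - b) + (b - c)" by (rule dvd_add)
    then show "[:- 1, 0, 1:] dvd a - c" by simp
  qed
qed

instantiation ratfun_pi :: comm_ring_1
begin

lift_definition zero_ratfun_pi :: ratfun_pi is 0 .
lift_definition one_ratfun_pi :: ratfun_pi is 1 .
lift_definition plus_ratfun_pi :: "ratfun_pi \<Rightarrow> ratfun_pi \<Rightarrow> ratfun_pi" is "(+)"
  by (metis add_diff_add dvd_add)
lift_definition uminus_ratfun_pi :: "ratfun_pi \<Rightarrow> ratfun_pi" is uminus
  by (metis dvd_minus_iff minus_diff_minus)
lift_definition minus_ratfun_pi :: "ratfun_pi \<Rightarrow> ratfun_pi \<Rightarrow> ratfun_pi" is "(-)"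
proof -
  fix a b c d :: "ratfun poly"
  assume "[:- 1, 0, 1:] dvd a - b" "[:- 1, 0, 1:] dvd c - d"
  then have "[:- 1, 0, 1:] dvd (a - b) - (c - d)" by (rule dvd_diff)
  then show "[:- 1, 0, 1:] dvd (a - c) - (b - d)" by (simp add: algebra_simps)
qed
lift_definition times_ratfun_pi :: "ratfun_pi \<Rightarrow> ratfun_pi \<Rightarrow> ratfun_pi" is "(*)"
proof -
  fix a b c d :: "ratfun poly"
  assume "[:- 1, 0, 1:] dvd a - b" "[:- 1, 0, 1:] dvd c - d"
  then have "[:- 1, 0, 1:] dvd (a - b) * c + b * (c - d)"
    by (intro dvd_add dvd_mult dvd_mult2)
  then show "[:- 1, 0, 1:] dvd a * c - b * d" by (simp add: algebra_simps)
qed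

instance
proof
  show "(0 :: ratfun_pi) \<noteq> 1"
  proof (transfer, rule notI)
    assume "[:- 1, 0, 1:] dvd (0 :: ratfun poly) - 1"
    then have "[:- 1, 0, 1:] dvd (1 :: ratfun poly)" by simp
    then have "degree ([:- 1, 0, 1:] :: ratfun poly) \<le> degree (1 :: ratfun poly)"
      by (rule dvd_imp_degree_le) simp
    then show False by simp
  qed
qed (transfer; simp add: algebra_simps)+

end

text \<open>
  \<open>\<rat>(q)[\<pi>]/(\<pi>\<^sup>2 - 1)\<close> has zero divisors. As usual, \<open>inverse\<close> is the true inverse on units and
  is 0 elsewhere; it also gives meaning to the powers \<open>x powi k\<close> with negative exponent.
\<close>

instantiation ratfun_pi :: inverse
begin

definition inverse_ratfun_pi :: "ratfun_pi \<Rightarrow> ratfun_pi" where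
  "inverse (x :: ratfun_pi) = (if x dvd 1 then (THE y. x * y = 1) else 0)"

definition divide_ratfun_pi :: "ratfun_pi \<Rightarrow> ratfun_pi \<Rightarrow> ratfun_pi" where
  "x div y = x * inverse (y :: ratfun_pi)"

instance ..

end

lemma ratfun_pi_inverse_unique:
  fixes x y :: ratfun_pi
  assumes "x * y = 1"
  shows "inverse x = y"
proof -
  have "x dvd 1" using assms by (metis dvdI)
  moreover have "(THE y. x * y = 1) = y"
  proof (rule the_equality)
    fix z assume "x * z = 1"
    have "z = (x * y) * z" using assms by simp
    also have "\<dots> = y * (x * z)" by (simp add: ac_simps)
    finally show "z = y" using \<open>x * z = 1\<close> by simp
  qed (rule assms)
  ultimately show ?thesis by (simp add: inverse_ratfun_pi_def)
qed

definition ratfun_pi_of :: "ratfun \<Rightarrow> ratfun_pi" where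
  "ratfun_pi_of c = abs_ratfun_pi [:c:]"

lift_definition pi_elt :: ratfun_pi is "[:0, 1:]" .

definition q_elt :: ratfun_pi where
  "q_elt = ratfun_pi_of (Fract [:0, 1:] 1)"

lemma pi_elt_square: "pi_elt * pi_elt = 1"
  by transfer (simp add: one_pCons)

lemma q_elt_inverse: "q_elt * inverse q_elt = 1"
proof -
  have "Fract [:0, 1:] [:0, 1:] = (1 :: ratfun)"
    unfolding One_fract_def by (subst eq_fract) simp_all
  then have "q_elt * ratfun_pi_of (Fract 1 [:0, 1:]) = 1"
    by (simp add: q_elt_def ratfun_pi_of_def times_ratfun_pi.abs_eq one_ratfun_pi_def one_pCons)
  then show ?thesis using ratfun_pi_inverse_unique by metis
qed


section \<open>Super Cartan data and root data\<close>

text \<open>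
  The index set \<open>I\<close> is the finite type \<open>'i\<close>. The symmetric bilinear form on \<open>\<int>[I]\<close> is given by
  its values on the basis \<open>I\<close>.
\<close>

record 'i cartan_data =
  odd_part :: "'i set"
  cdot :: "'i \<Rightarrow> 'i \<Rightarrow> int"

definition super_cartan_datum :: "'i::finite cartan_data \<Rightarrow> bool" where
  "super_cartan_datum C \<longleftrightarrow>
     odd_part C \<noteq> {} \<and>
     (\<forall>i j. cdot C i j = cdot C j i) \<and>
     (\<forall>i. even (cdot C i i) \<and> cdot C i i div 2 > 0) \<and>
     (\<forall>i j. i \<noteq> j \<longrightarrow> (\<exists>k::nat. 2 * cdot C i j = - int k * cdot C i i)) \<and>
     (\<forall>i \<in> odd_part C. \<forall>j. \<exists>k::int. 2 * cdot C i j = (2 * k) * cdot C i i)"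

definition dd :: "'i cartan_data \<Rightarrow> 'i \<Rightarrow> int" where
  "dd C i = cdot C i i div 2"

definition parity :: "'i cartan_data \<Rightarrow> 'i \<Rightarrow> nat" where
  "parity C i = (if i \<in> odd_part C then 1 else 0)"

definition q_i :: "'i cartan_data \<Rightarrow> 'i \<Rightarrow> ratfun_pi" where
  "q_i C i = q_elt powi dd C i"

definition pi_i :: "'i cartan_data \<Rightarrow> 'i \<Rightarrow> ratfun_pi" where
  "pi_i C i = pi_elt ^ parity C i"

definition qnum :: "'i cartan_data \<Rightarrow> 'i \<Rightarrow> nat \<Rightarrow> ratfun_pi" where
  "qnum C i n = ((pi_i C i * q_i C i) ^ n - q_i C i powi (- int n))
                  / (pi_i C i * q_i C i - inverse (q_i C i))"

definition qfact :: "'i cartan_data \<Rightarrow> 'i \<Rightarrow> nat \<Rightarrow> ratfun_pi" where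
  "qfact C i n = (\<Prod>s = 1..n. qnum C i s)"

definition int_scale :: "int \<Rightarrow> 'a::ab_group_add \<Rightarrow> 'a" where
  "int_scale k x = (if k \<ge> 0 then (\<Sum>_<nat k. x) else - (\<Sum>_<nat (- k). x))"

definition int_independent :: "'a::ab_group_add set \<Rightarrow> bool" where
  "int_independent S \<longleftrightarrow>
     (\<forall>T u. finite T \<longrightarrow> T \<subseteq> S \<longrightarrow> (\<Sum>v\<in>T. int_scale (u v) v) = 0 \<longrightarrow> (\<forall>v\<in>T. u v = 0))"

definition fg_free_abelian :: "'a::ab_group_add itself \<Rightarrow> bool" where
  "fg_free_abelian _ \<longleftrightarrow>
     (\<exists>B::'a set. finite B \<and> int_independent B \<and>
        (\<forall>x. \<exists>u. x = (\<Sum>b\<in>B. int_scale (u b) b)))"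

definition perfect_pairing :: "('y::ab_group_add \<Rightarrow> 'x::ab_group_add \<Rightarrow> int) \<Rightarrow> bool" where
  "perfect_pairing f \<longleftrightarrow>
     (\<forall>y. additive (f y)) \<and> (\<forall>x. additive (\<lambda>y. f y x)) \<and>
     bij_betw f UNIV {g. additive g} \<and>
     bij_betw (\<lambda>x y. f y x) UNIV {g. additive g}"

text \<open>\<open>simple_coroot\<close> is the embedding \<open>I \<subset> Y\<close> (\<open>i \<mapsto> i\<close>), \<open>simple_root\<close> is the embedding \<open>I \<subset> X\<close> (\<open>i \<mapsto> i'\<close>).\<close>

record ('i, 'y, 'x) root_data =
  pairing :: "'y \<Rightarrow> 'x \<Rightarrow> int"
  simple_coroot :: "'i \<Rightarrow> 'y"
  simple_root :: "'i \<Rightarrow> 'x"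

definition root_datum ::
    "'i::finite cartan_data \<Rightarrow> ('i, 'y::ab_group_add, 'x::ab_group_add) root_data \<Rightarrow> bool" where
  "root_datum C R \<longleftrightarrow>
     fg_free_abelian TYPE('y) \<and> fg_free_abelian TYPE('x) \<and>
     perfect_pairing (pairing R) \<and>
     inj (simple_coroot R) \<and> int_independent (range (simple_coroot R)) \<and>
     inj (simple_root R) \<and> int_independent (range (simple_root R)) \<and>
     (\<forall>i j. pairing R (simple_coroot R i) (simple_root R j) * cdot C i i = 2 * cdot C i j)"


section \<open>Free associative algebras\<close>

text \<open>
  The free monoid, written additively so that \<open>'a word \<Rightarrow>\<^sub>0 ratfun_pi\<close> with the convolution
  product of \<open>Poly_Mapping\<close> is the free associative unital algebra on \<open>'a\<close>.
\<close>

datatype 'a word = Word (letters: "'a list")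

instantiation word :: (type) monoid_add
begin

definition zero_word :: "'a word" where "0 = Word []"
definition plus_word :: "'a word \<Rightarrow> 'a word \<Rightarrow> 'a word" where
  "u + v = Word (letters u @ letters v)"

instance
  by standard (simp_all add: zero_word_def plus_word_def)

end

type_synonym 'a free_alg = "'a word \<Rightarrow>\<^sub>0 ratfun_pi"

definition gen :: "'a \<Rightarrow> 'a free_alg" where
  "gen a = Poly_Mapping.single (Word [a]) 1"

definition scale :: "ratfun_pi \<Rightarrow> ('b \<Rightarrow>\<^sub>0 ratfun_pi) \<Rightarrow> ('b \<Rightarrow>\<^sub>0 ratfun_pi)" where
  "scale c x = Poly_Mapping.map (\<lambda>a. c * a) x"

definition subst_alg :: "('a \<Rightarrow> 'b free_alg) \<Rightarrow> 'a free_alg \<Rightarrow> 'b free_alg" where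
  "subst_alg g f =
     (\<Sum>w\<in>Poly_Mapping.keys f. scale (Poly_Mapping.lookup f w) (prod_list (map g (letters w))))"


section \<open>The bilinear form on the free algebra and its radical\<close>

text \<open>
  The algebra \<open>'f\<close> is \<open>'i free_alg\<close>, with \<open>gen i\<close> in the role of \<open>\<theta>\<^sub>i\<close>. Every word \<open>w\<close> is
  homogeneous; \<open>word_parity C w\<close> is \<open>p(|w|)\<close> and \<open>word_dot C u v\<close> is \<open>|u| \<cdot> |v|\<close>.
\<close>

definition word_parity :: "'i cartan_data \<Rightarrow> 'i word \<Rightarrow> nat" where
  "word_parity C w = sum_list (map (parity C) (letters w))"

definition word_dot :: "'i cartan_data \<Rightarrow> 'i word \<Rightarrow> 'i word \<Rightarrow> int" where
  "word_dot C u v = (\<Sum>i\<leftarrow>letters u. \<Sum>j\<leftarrow>letters v. cdot C i j)"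

text \<open>\<open>'f \<otimes> 'f\<close> is the free module on pairs of words, with \<open>u \<otimes> v\<close> corresponding to \<open>(u, v)\<close>.\<close>

type_synonym 'i tensor_alg = "('i word \<times> 'i word) \<Rightarrow>\<^sub>0 ratfun_pi"

definition tensor :: "'i free_alg \<Rightarrow> 'i free_alg \<Rightarrow> 'i tensor_alg" where
  "tensor x y =
     (\<Sum>u\<in>Poly_Mapping.keys x. \<Sum>v\<in>Poly_Mapping.keys y.
        Poly_Mapping.single (u, v) (Poly_Mapping.lookup x u * Poly_Mapping.lookup y v))"

definition tensor_mult ::
    "'i cartan_data \<Rightarrow> 'i tensor_alg \<Rightarrow> 'i tensor_alg \<Rightarrow> 'i tensor_alg" where
  "tensor_mult C S T =
     (\<Sum>(u1, u2)\<in>Poly_Mapping.keys S. \<Sum>(v1, v2)\<in>Poly_Mapping.keys T.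
        Poly_Mapping.single (u1 + v1, u2 + v2)
          (Poly_Mapping.lookup S (u1, u2) * Poly_Mapping.lookup T (v1, v2) *
           (q_elt powi word_dot C u2 v1 * pi_elt ^ (word_parity C u2 * word_parity C v1))))"

definition coprod_word :: "'i cartan_data \<Rightarrow> 'i word \<Rightarrow> 'i tensor_alg" where
  "coprod_word C w =
     foldr (\<lambda>i. tensor_mult C (tensor (gen i) 1 + tensor 1 (gen i))) (letters w) (tensor 1 1)"

text \<open>\<open>coprod C\<close> is the algebra homomorphism \<open>r : 'f \<rightarrow> 'f \<otimes> 'f\<close>, \<open>\<theta>\<^sub>i \<mapsto> \<theta>\<^sub>i \<otimes> 1 + 1 \<otimes> \<theta>\<^sub>i\<close>.\<close>

definition coprod :: "'i cartan_data \<Rightarrow> 'i free_alg \<Rightarrow> 'i tensor_alg" where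
  "coprod C x = (\<Sum>w\<in>Poly_Mapping.keys x. scale (Poly_Mapping.lookup x w) (coprod_word C w))"

text \<open>The bilinear extension of \<open>(x\<^sub>1 \<otimes> x\<^sub>2, y\<^sub>1 \<otimes> y\<^sub>2) = (x\<^sub>1, y\<^sub>1)(x\<^sub>2, y\<^sub>2)\<close>.\<close>

definition tensor_form ::
    "('i free_alg \<Rightarrow> 'i free_alg \<Rightarrow> ratfun_pi) \<Rightarrow> 'i tensor_alg \<Rightarrow> 'i tensor_alg \<Rightarrow> ratfun_pi" where
  "tensor_form B S T =
     (\<Sum>(u1, u2)\<in>Poly_Mapping.keys S. \<Sum>(v1, v2)\<in>Poly_Mapping.keys T.
        Poly_Mapping.lookup S (u1, u2) * Poly_Mapping.lookup T (v1, v2) *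
        (B (Poly_Mapping.single u1 1) (Poly_Mapping.single v1 1) *
         B (Poly_Mapping.single u2 1) (Poly_Mapping.single v2 1)))"

definition is_lusztig_form ::
    "'i cartan_data \<Rightarrow> ('i free_alg \<Rightarrow> 'i free_alg \<Rightarrow> ratfun_pi) \<Rightarrow> bool" where
  "is_lusztig_form C B \<longleftrightarrow>
     (\<forall>x x' y. B (x + x') y = B x y + B x' y) \<and>
     (\<forall>x y y'. B x (y + y') = B x y + B x y') \<and>
     (\<forall>c x y. B (scale c x) y = c * B x y) \<and>
     (\<forall>c x y. B x (scale c y) = c * B x y) \<and>
     B 1 1 = 1 \<and>
     (\<forall>i j. B (gen i) (gen j) =
        (if i = j then inverse (1 - pi_i C i * q_i C i powi (- 2)) else 0)) \<and>
     (\<forall>x y' y''. B x (y' * y'') = tensor_form B (coprod C x) (tensor y' y'')) \<and>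
     (\<forall>x x' y''. B (x * x') y'' = tensor_form B (tensor x x') (coprod C y''))"

text \<open>
  For a super Cartan datum exactly one such form exists, and it is symmetric; so the left radical
  used below is the radical.
\<close>

definition lusztig_form ::
    "'i cartan_data \<Rightarrow> 'i free_alg \<Rightarrow> 'i free_alg \<Rightarrow> ratfun_pi" where
  "lusztig_form C = (THE B. is_lusztig_form C B)"

definition form_radical :: "'i cartan_data \<Rightarrow> 'i free_alg set" where
  "form_radical C = {x. \<forall>y. lusztig_form C x y = 0}"


section \<open>The quantum covering group\<close>

datatype ('i, 'y) U_gen = E_gen 'i | F_gen 'i | J_gen 'y | K_gen 'y

abbreviation "fE i \<equiv> gen (E_gen i)"
abbreviation "fF i \<equiv> gen (F_gen i)"
abbreviation "fJ \<mu> \<equiv> gen (J_gen \<mu>)"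
abbreviation "fK \<mu> \<equiv> gen (K_gen \<mu>)"

text \<open>\<open>U_relation C R a b\<close> means that \<open>a = b\<close> is one of the defining relations.\<close>

inductive U_relation ::
    "'i::finite cartan_data \<Rightarrow> ('i, 'y::ab_group_add, 'x::ab_group_add) root_data \<Rightarrow>
     ('i, 'y) U_gen free_alg \<Rightarrow> ('i, 'y) U_gen free_alg \<Rightarrow> bool"
  for C R where
  K_zero: "U_relation C R (fK 0) 1"
| K_add: "U_relation C R (fK \<mu> * fK \<mu>') (fK (\<mu> + \<mu>'))"
| J_double: "U_relation C R (fJ (int_scale 2 \<mu>)) 1"
| J_add: "U_relation C R (fJ \<mu> * fJ \<mu>') (fJ (\<mu> + \<mu>'))"
| J_K: "U_relation C R (fJ \<mu> * fK \<mu>') (fK \<mu>' * fJ \<mu>)"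
| K_E: "U_relation C R (fK \<mu> * fE i) (scale (q_elt powi pairing R \<mu> (simple_root R i)) (fE i * fK \<mu>))"
| J_E: "U_relation C R (fJ \<mu> * fE i) (scale (pi_elt powi pairing R \<mu> (simple_root R i)) (fE i * fJ \<mu>))"
| K_F: "U_relation C R (fK \<mu> * fF i) (scale (q_elt powi (- pairing R \<mu> (simple_root R i))) (fF i * fK \<mu>))"
| J_F: "U_relation C R (fJ \<mu> * fF i) (scale (pi_elt powi (- pairing R \<mu> (simple_root R i))) (fF i * fJ \<mu>))"
| E_F: "U_relation C R
     (fE i * fF j - scale (pi_elt ^ (parity C i * parity C j)) (fF j * fE i))
     (if i = j then
        scale (inverse (pi_i C i * q_i C i - inverse (q_i C i)))
          (fJ (int_scale (dd C i) (simple_coroot R i)) * fK (int_scale (dd C i) (simple_coroot R i))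
           - fK (int_scale (- dd C i) (simple_coroot R i)))
      else 0)"
| Serre_E: "f \<in> form_radical C \<Longrightarrow> U_relation C R (subst_alg (\<lambda>i. fE i) f) 0"
| Serre_F: "f \<in> form_radical C \<Longrightarrow> U_relation C R (subst_alg (\<lambda>i. fF i) f) 0"

definition U_ideal ::
    "'i::finite cartan_data \<Rightarrow> ('i, 'y::ab_group_add, 'x::ab_group_add) root_data \<Rightarrow>
     ('i, 'y) U_gen free_alg set" where
  "U_ideal C R = Idl\<^bsub>ring_of_type_algebra\<^esub> {a - b | a b. U_relation C R a b}"

definition U_alg ::
    "'i::finite cartan_data \<Rightarrow> ('i, 'y::ab_group_add, 'x::ab_group_add) root_data \<Rightarrow>
     ('i, 'y) U_gen free_alg set ring" where
  "U_alg C R = ring_of_type_algebra Quot U_ideal C R"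

definition U_class ::
    "'i::finite cartan_data \<Rightarrow> ('i, 'y::ab_group_add, 'x::ab_group_add) root_data \<Rightarrow>
     ('i, 'y) U_gen free_alg \<Rightarrow> ('i, 'y) U_gen free_alg set" where
  "U_class C R x = U_ideal C R +>\<^bsub>ring_of_type_algebra\<^esub> x"

text \<open>
  \<open>U_alg C R\<close> is the quotient ring; since scalars \<open>scale c 1\<close> are central, they act on it
  through multiplication by their classes.
\<close>

definition U_scale ::
    "'i::finite cartan_data \<Rightarrow> ('i, 'y::ab_group_add, 'x::ab_group_add) root_data \<Rightarrow>
     ratfun_pi \<Rightarrow> ('i, 'y) U_gen free_alg set \<Rightarrow> ('i, 'y) U_gen free_alg set" where
  "U_scale C R c a = U_class C R (scale c 1) \<otimes>\<^bsub>U_alg C R\<^esub> a"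

definition E_div ::
    "'i::finite cartan_data \<Rightarrow> ('i, 'y::ab_group_add, 'x::ab_group_add) root_data \<Rightarrow>
     'i \<Rightarrow> nat \<Rightarrow> ('i, 'y) U_gen free_alg set" where
  "E_div C R i n = U_scale C R (inverse (qfact C i n)) (U_class C R (fE i) [^]\<^bsub>U_alg C R\<^esub> n)"

definition serre_exponent :: "'i cartan_data \<Rightarrow> nat \<Rightarrow> nat \<Rightarrow> 'i \<Rightarrow> 'i \<Rightarrow> nat" where
  "serre_exponent C n r i j = r * n * parity C i * parity C j + (r choose 2) * parity C i"

definition serre_elt ::
    "'i::finite cartan_data \<Rightarrow> ('i, 'y::ab_group_add, 'x::ab_group_add) root_data \<Rightarrow>
     'i \<Rightarrow> 'i \<Rightarrow> nat \<Rightarrow> nat \<Rightarrow> ('i, 'y) U_gen free_alg set" where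
  "serre_elt C R i j n m =
     finsum (U_alg C R) (\<lambda>(r, s).
        U_scale C R
          ((- 1) ^ r * pi_i C i ^ serre_exponent C n r i j *
           (pi_i C i * q_i C i) powi
             (- (int r * (int n * pairing R (simple_coroot R i) (simple_root R j) + int m - 1))))
          (E_div C R i r \<otimes>\<^bsub>U_alg C R\<^esub> E_div C R j n \<otimes>\<^bsub>U_alg C R\<^esub> E_div C R i s))
       {(r, s). r + s = m}"

end

theory Submission
  imports Defs
begin

text \<open>
  In \<open>\<^bold>U\<close> every element of the radical of Lusztig's form vanishes after substituting \<open>E\<^sub>i\<close> for
  \<open>\<theta>\<^sub>i\<close>. So it suffices to show that the element \<open>s\<^bsub>n,m\<^esub>\<close> of the free algebra that is
  obtained by writing \<open>\<theta>\<^sub>i\<close> for \<open>E\<^sub>i\<close> in \<open>e\<^bsub>i,j;n,m\<^esub>\<close> lies in the radical whenever \<open>m > -n\<alpha>\<close>, where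
  \<open>\<alpha> = \<langle>i,j'\<rangle>\<close>.

  For each \<open>k\<close> there is a skew derivation \<open>\<partial>\<^sub>k\<close> with
  \<open>\<partial>\<^sub>k(\<theta>\<^sub>l x) = \<delta>\<^sub>k\<^sub>l x + q\<^bsup>k\<cdot>l\<^esup> \<pi>\<^bsup>p(k)p(l)\<^esup> \<theta>\<^sub>l \<partial>\<^sub>k(x)\<close>. It is adjoint to left multiplication by
  \<open>\<theta>\<^sub>k\<close>, up to the scalar \<open>(\<theta>\<^sub>k,\<theta>\<^sub>k)\<close>. Hence an element without constant term
  lies in the radical as soon as all its skew derivatives do (\<open>in_radicalI\<close>). A direct computation gives

  \<^item> \<open>\<partial>\<^sub>k s\<^bsub>n,m\<^esub> = 0\<close> for \<open>k \<noteq> i, j\<close>;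
  \<^item> \<open>\<partial>\<^sub>j s\<^bsub>n,m\<^esub> = q\<^sub>j\<^bsup>n-1\<^esup> s\<^bsub>n-1,m\<^esub>\<close>, and \<open>0\<close> if \<open>n = 0\<close> (\<open>skew_der_serre_j\<close>, \<open>skew_der_serre_0\<close>);
  \<^item> \<open>\<partial>\<^sub>i s\<^bsub>n,m\<^esub> = \<pi>\<^sub>i\<^bsup>np(j)\<^esup> (q\<^sub>i\<^sup>N - (\<pi>\<^sub>iq\<^sub>i)\<^sup>-\<^sup>N) s\<^bsub>n,m-1\<^esub>\<close> for \<open>m > 0\<close>, with
    \<open>N = n\<alpha> + m - 1\<close> (\<open>skew_der_serre_i\<close>).

  The last scalar vanishes exactly in the boundary case \<open>N = 0\<close>, that is \<open>m = 1 - n\<alpha>\<close>. Thus the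
  claim follows by induction on \<open>n + m\<close> (\<open>serre_free_in_radical\<close>).

  As the form is introduced as the unique one satisfying the axioms, its existence and uniqueness
  have to be established. It is built by declaring left multiplication by \<open>\<theta>\<^sub>i\<close> adjoint to
  \<open>\<partial>\<^sub>i\<close> in one argument. It then follows that the same holds in the other argument, that the
  form is symmetric, and that it is compatible with the coproduct (\<open>form_is_lusztig_form\<close>,
  \<open>lusztig_form_unique\<close>).
\<close>

section \<open>Linear maps on free modules\<close>

lemma lookup_scale: "Poly_Mapping.lookup (scale c x) k = c * Poly_Mapping.lookup x k"
  by (simp add: scale_def Poly_Mapping.map.rep_eq when_def)

interpretation free_mod: Modules.module "scale :: ratfun_pi \<Rightarrow> ('b \<Rightarrow>\<^sub>0 ratfun_pi) \<Rightarrow> _"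
  by standard (rule poly_mapping_eqI, simp add: lookup_scale lookup_add algebra_simps)+

lemma scalar_module: "Modules.module ((*) :: ratfun_pi \<Rightarrow> ratfun_pi \<Rightarrow> _)"
  by standard (simp_all add: algebra_simps)

abbreviation linear_map :: "(('a \<Rightarrow>\<^sub>0 ratfun_pi) \<Rightarrow> ('b \<Rightarrow>\<^sub>0 ratfun_pi)) \<Rightarrow> bool" where
  "linear_map \<equiv> Modules.module_hom scale scale"

abbreviation linear_functional :: "(('a \<Rightarrow>\<^sub>0 ratfun_pi) \<Rightarrow> ratfun_pi) \<Rightarrow> bool" where
  "linear_functional \<equiv> Modules.module_hom scale (*)"

text \<open>
  The linear extension of a map from the basis into an arbitrary module. All operations on free
  algebras and tensors become instances of it, so that an identity that is linear in each argument
  only has to be checked on basis elements (see \<open>hom_eq_on_basis\<close>).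
\<close>

definition lin :: "(ratfun_pi \<Rightarrow> 'c \<Rightarrow> 'c::ab_group_add) \<Rightarrow> ('a \<Rightarrow> 'c) \<Rightarrow> ('a \<Rightarrow>\<^sub>0 ratfun_pi) \<Rightarrow> 'c" where
  "lin s f x = (\<Sum>w\<in>Poly_Mapping.keys x. s (Poly_Mapping.lookup x w) (f w))"

lemma lin_superset:
  assumes "Modules.module s" "finite A" "Poly_Mapping.keys x \<subseteq> A"
  shows "lin s f x = (\<Sum>w\<in>A. s (Poly_Mapping.lookup x w) (f w))"
proof -
  interpret Modules.module s by fact
  show ?thesis unfolding lin_def
    by (rule sum.mono_neutral_left) (use assms(2,3) in \<open>auto simp: in_keys_iff\<close>)
qed

lemma lin_hom:
  assumes "Modules.module s"
  shows "Modules.module_hom scale s (lin s f)"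
proof -
  interpret s: Modules.module s by fact
  have add: "lin s f (x + y) = lin s f x + lin s f y" for x y
  proof -
    let ?A = "Poly_Mapping.keys x \<union> Poly_Mapping.keys y"
    have "Poly_Mapping.keys (x + y) \<subseteq> ?A" by (rule keys_add)
    then show ?thesis
      by (simp add: lin_superset[OF assms, of ?A] lookup_add s.scale_left_distrib sum.distrib)
  qed
  have scale: "lin s f (scale c x) = s c (lin s f x)" for c x
  proof -
    have "Poly_Mapping.keys (scale c x) \<subseteq> Poly_Mapping.keys x"
      by (auto simp: in_keys_iff lookup_scale)
    then show ?thesis
      by (simp add: lin_superset[OF assms, of "Poly_Mapping.keys x"] lookup_scale s.scale_sum_right)
  qed
  show ?thesis
    by (simp add: Modules.module_hom_iff free_mod.module_axioms assms add scale)
qed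

lemma lin_single:
  assumes "Modules.module s"
  shows "lin s f (Poly_Mapping.single w c) = s c (f w)"
proof -
  interpret s: Modules.module s by fact
  show ?thesis
    by (subst lin_superset[OF assms, of "{w}"]) simp_all
qed

lemma scale_single: "scale c (Poly_Mapping.single w d) = Poly_Mapping.single w (c * d)"
  by (rule poly_mapping_eqI) (simp add: lookup_scale lookup_single when_def)

lemma sum_basis:
  "x = (\<Sum>w\<in>Poly_Mapping.keys x. scale (Poly_Mapping.lookup x w) (Poly_Mapping.single w 1))"
proof (rule poly_mapping_eqI)
  fix k
  show "Poly_Mapping.lookup x k = Poly_Mapping.lookup
    (\<Sum>w\<in>Poly_Mapping.keys x. scale (Poly_Mapping.lookup x w) (Poly_Mapping.single w 1)) k"
    by (simp add: lookup_sum scale_single lookup_single when_def in_keys_iff)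
qed

lemma hom_eq_on_basis:
  assumes f: "Modules.module_hom scale s f" and g: "Modules.module_hom scale s g"
    and eq: "\<And>w. f (Poly_Mapping.single w 1) = g (Poly_Mapping.single w 1)"
  shows "f x = g x"
proof -
  interpret f: Modules.module_hom scale s f by fact
  interpret g: Modules.module_hom scale s g by fact
  show ?thesis
    by (subst (1 2) sum_basis) (simp add: f.sum g.sum f.scale g.scale eq)
qed

lemma hom_comp:
  "Modules.module_hom s2 s3 g \<Longrightarrow> Modules.module_hom s1 s2 f \<Longrightarrow> Modules.module_hom s1 s3 (\<lambda>x. g (f x))"
  by (simp add: Modules.module_hom_iff)

lemma scale_conv_mult: "scale c x = Poly_Mapping.single 0 c * (x :: 'a free_alg)"
  by (simp add: scale_def mult_map_scale_conv_mult[symmetric])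

lemma scale_mult_left: "scale c x * y = scale c (x * (y :: 'a free_alg))"
  by (simp add: scale_conv_mult mult.assoc)

lemma scale_mult_right: "x * scale c y = scale c (x * (y :: 'a free_alg))"
proof -
  have "x * Poly_Mapping.single 0 c = scale c x"
  proof (rule hom_eq_on_basis[where s = scale and g = "scale c"])
    show "linear_map (\<lambda>x :: 'a free_alg. x * Poly_Mapping.single 0 c)"
      by (simp add: Modules.module_hom_iff free_mod.module_axioms distrib_right scale_mult_left)
    show "linear_map (scale c :: 'a free_alg \<Rightarrow> 'a free_alg)"
      by (rule free_mod.module_hom_scale_self)
  qed (simp add: mult_single scale_single)
  then show ?thesis
    by (metis mult.assoc scale_conv_mult scale_mult_left)
qed

lemma hom_add: "Modules.module_hom s1 s2 f \<Longrightarrow> Modules.module_hom s1 s2 g \<Longrightarrow>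
    Modules.module_hom s1 s2 (\<lambda>x. f x + g x)"
  by (simp add: Modules.module_hom_iff Modules.module.scale_right_distrib)

lemma hom_scale: "Modules.module_hom s1 scale f \<Longrightarrow> Modules.module_hom s1 scale (\<lambda>x. scale c (f x))"
  by (simp add: Modules.module_hom_iff algebra_simps)

lemma hom_times:
  "Modules.module_hom s1 (*) f \<Longrightarrow> Modules.module_hom s1 (*) (\<lambda>x. c * f x)"
  "Modules.module_hom s1 (*) f \<Longrightarrow> Modules.module_hom s1 (*) (\<lambda>x. f x * (c :: ratfun_pi))"
  by (simp_all add: Modules.module_hom_iff algebra_simps)

lemma hom_alg_mult:
  fixes f :: "'c::ab_group_add \<Rightarrow> 'a free_alg"
  shows "Modules.module_hom s1 scale f \<Longrightarrow> Modules.module_hom s1 scale (\<lambda>x. f x * a)"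
    and "Modules.module_hom s1 scale f \<Longrightarrow> Modules.module_hom s1 scale (\<lambda>x. a * f x)"
  by (simp_all add: Modules.module_hom_iff distrib_left distrib_right scale_mult_left
      scale_mult_right)

lemma hom_if: "Modules.module_hom s1 s2 f \<Longrightarrow> Modules.module_hom s1 s2 g \<Longrightarrow>
    Modules.module_hom s1 s2 (\<lambda>x. if b then f x else g x)"
  by (cases b) simp_all

lemma hom_coeff: "linear_functional (\<lambda>x. Poly_Mapping.lookup x w)"
  by (simp add: Modules.module_hom_iff free_mod.module_axioms scalar_module lookup_add lookup_scale)

text \<open>
  Iterated linear extensions are also linear in the inner argument; this gives bilinearity of
  tensors, of their product and of the induced form.
\<close>

lemma hom_lin_pointwise:
  assumes "Modules.module s1" "Modules.module s" "\<And>w. Modules.module_hom s1 s (\<lambda>x. f x w)"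
  shows "Modules.module_hom s1 s (\<lambda>x. lin s (f x) y)"
proof -
  interpret s: Modules.module s by fact
  have add: "f (x + x') w = f x w + f x' w" and scale: "f (s1 c x) w = s c (f x w)" for x x' c w
    using assms(3)[of w] by (auto simp: Modules.module_hom_iff)
  have "lin s (f (x + x')) y = lin s (f x) y + lin s (f x') y" for x x'
    unfolding lin_def add s.scale_right_distrib sum.distrib ..
  moreover have "lin s (f (s1 c x)) y = s c (lin s (f x) y)" for c x
    unfolding lin_def scale s.scale_sum_right by (rule sum.cong[OF refl s.scale_left_commute])
  ultimately show ?thesis
    unfolding Modules.module_hom_iff using assms(1,2) by blast
qed

lemmas lin_free_hom = lin_hom[OF free_mod.module_axioms]
lemmas lin_scalar_hom = lin_hom[OF scalar_module]
lemmas lin_free_single = lin_single[OF free_mod.module_axioms]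
lemmas lin_scalar_single = lin_single[OF scalar_module]

lemma zero_hom: "linear_map (\<lambda>x. 0)" "linear_functional (\<lambda>x. 0)"
  by (simp_all add: Modules.module_hom_iff free_mod.module_axioms scalar_module)

lemmas homs = hom_add hom_scale hom_times hom_alg_mult hom_if
  free_mod.module_hom_ident zero_hom

section \<open>Tensors and the coproduct\<close>

lemma tensor_eq_lin:
  "tensor x y = lin scale (\<lambda>u. lin scale (\<lambda>v. Poly_Mapping.single (u, v) 1) y) x"
  by (simp add: tensor_def lin_def scale_single free_mod.scale_sum_right)

lemma tensor_single [simp]: "tensor (Poly_Mapping.single u a) (Poly_Mapping.single v b) =
    Poly_Mapping.single (u, v) (a * b)"
  by (simp add: tensor_eq_lin lin_free_single scale_single)

lemma tensor_hom_left: "linear_map (\<lambda>x. tensor x y)"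
  unfolding tensor_eq_lin by (rule lin_free_hom)

lemma tensor_hom_right: "linear_map (\<lambda>y. tensor x y)"
  unfolding tensor_eq_lin by (rule hom_lin_pointwise[OF free_mod.module_axioms
      free_mod.module_axioms lin_free_hom])

lemma tensor_form_eq_lin: "tensor_form B S T =
    lin (*) (\<lambda>u. lin (*) (\<lambda>v. B (Poly_Mapping.single (fst u) 1) (Poly_Mapping.single (fst v) 1) *
         B (Poly_Mapping.single (snd u) 1) (Poly_Mapping.single (snd v) 1)) T) S"
  by (simp add: tensor_form_def lin_def split_beta sum_distrib_left mult.assoc)

lemma tensor_form_hom_left: "linear_functional (\<lambda>S. tensor_form B S T)"
  unfolding tensor_form_eq_lin by (rule lin_scalar_hom)

lemma tensor_form_hom_right: "linear_functional (\<lambda>T. tensor_form B S T)"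
  unfolding tensor_form_eq_lin by (rule hom_lin_pointwise[OF free_mod.module_axioms
      scalar_module lin_scalar_hom])

lemma tensor_form_single: "tensor_form B (Poly_Mapping.single (u1, u2) a) (Poly_Mapping.single
    (v1, v2) b)
   = a * b * (B (Poly_Mapping.single u1 1) (Poly_Mapping.single v1 1) *
         B (Poly_Mapping.single u2 1) (Poly_Mapping.single v2 1))"
  by (simp add: tensor_form_eq_lin lin_scalar_single)

lemma tensor_mult_eq_lin: "tensor_mult C S T =
    lin scale (\<lambda>u. lin scale (\<lambda>v. Poly_Mapping.single (fst u + fst v, snd u + snd v)
      (q_elt powi word_dot C (snd u) (fst v) * pi_elt ^ (word_parity C (snd u) *
          word_parity C (fst v)))) T) S"
  by (simp add: tensor_mult_def lin_def split_beta free_mod.scale_sum_right scale_single mult.assoc)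

lemma tensor_mult_hom_left: "linear_map (\<lambda>S. tensor_mult C S T)"
  unfolding tensor_mult_eq_lin by (rule lin_free_hom)

lemma tensor_mult_hom_right: "linear_map (\<lambda>T. tensor_mult C S T)"
  unfolding tensor_mult_eq_lin by (rule hom_lin_pointwise[OF free_mod.module_axioms
      free_mod.module_axioms lin_free_hom])

lemma tensor_mult_single: "tensor_mult C (Poly_Mapping.single (u1, u2) a) (Poly_Mapping.single
    (v1, v2) b) =
    Poly_Mapping.single (u1 + v1, u2 + v2) (a * b *
      (q_elt powi word_dot C u2 v1 * pi_elt ^ (word_parity C u2 * word_parity C v1)))"
  by (simp add: tensor_mult_eq_lin lin_free_single scale_single mult.assoc)

lemma coprod_eq_lin: "coprod C x = lin scale (coprod_word C) x"
  by (simp add: coprod_def lin_def)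

lemma coprod_hom: "linear_map (coprod C)"
  unfolding coprod_eq_lin[abs_def] by (rule lin_free_hom)

lemma coprod_single: "coprod C (Poly_Mapping.single w 1) = coprod_word C w"
  by (simp add: coprod_eq_lin lin_free_single)

section \<open>Units of the ground ring and integral powers\<close>

lemma unit_mult_inverse:
  fixes x :: ratfun_pi
  assumes "x dvd 1"
  shows "x * inverse x = 1"
  using assms ratfun_pi_inverse_unique by (metis dvdE)

lemma unit_inverse_mult:
  fixes x y :: ratfun_pi
  assumes "x dvd 1" "y dvd 1"
  shows "inverse (x * y) = inverse x * inverse y"
proof (rule ratfun_pi_inverse_unique)
  have "x * y * (inverse x * inverse y) = (x * inverse x) * (y * inverse y)"
    by (simp only: ac_simps)
  then show "x * y * (inverse x * inverse y) = 1"
    by (simp add: unit_mult_inverse assms)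
qed

lemma unit_powi_minus:
  fixes x :: ratfun_pi
  assumes "x dvd 1"
  shows "x powi a * x powi (- a) = 1"
  by (cases "a \<ge> 0")
    (simp_all add: power_int_def power_mult_distrib[symmetric] unit_mult_inverse[OF assms]
        mult.commute)

lemma unit_powi_Suc:
  fixes x :: ratfun_pi
  assumes "x dvd 1"
  shows "x powi (a + 1) = x powi a * x"
proof (cases "a \<ge> 0")
  case True
  then show ?thesis by (simp add: power_int_def nat_add_distrib mult.commute)
next
  case False
  then obtain k where a: "a = - int (Suc k)" by (metis not_le negative_eq_positive
      zless_iff_Suc_zadd add.left_neutral
      neg_less_iff_less neg_0_less_iff_less minus_minus int_ops(1) zero_less_imp_eq_int Suc_pred)
  have "x powi a * x = inverse x ^ k * (x * inverse x)"
    unfolding a power_int_def by (simp add: ac_simps nat_add_distrib)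
  also have "\<dots> = x powi (a + 1)"
    unfolding a power_int_def unit_mult_inverse[OF assms] by auto
  finally show ?thesis ..
qed

lemma unit_powi_add:
  fixes x :: ratfun_pi
  assumes "x dvd 1"
  shows "x powi (a + b) = x powi a * x powi b"
proof (induction b rule: int_induct[where k = 0])
  case base
  then show ?case by simp
next
  case (step1 i)
  then show ?case
    using unit_powi_Suc[OF assms, of "a + i"] unit_powi_Suc[OF assms, of i] by (simp add: ac_simps)
next
  case (step2 i)
  have "x powi (a + (i - 1)) * x = x powi a * x powi (i - 1) * x"
    using unit_powi_Suc[OF assms, of "a + (i - 1)"] unit_powi_Suc[OF assms, of "i - 1"] step2
    by (simp add: ac_simps)
  then have "x powi (a + (i - 1)) * (x * inverse x) = x powi a * x powi (i - 1) * (x * inverse x)"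
    by (simp only: mult.assoc[symmetric])
  then show ?case by (simp add: unit_mult_inverse[OF assms])
qed

lemma unit_powi_mult:
  fixes x :: ratfun_pi
  assumes "x dvd 1"
  shows "x powi (a * int n) = (x powi a) ^ n"
  by (induction n) (simp_all add: unit_powi_add[OF assms] distrib_left)

lemma unit_powi_mult_int:
  fixes x :: ratfun_pi
  assumes "x dvd 1"
  shows "x powi (a * b) = (x powi a) powi b"
proof (cases "b \<ge> 0")
  case True
  then show ?thesis
    using unit_powi_mult[OF assms, of a "nat b"] by (simp add: power_int_def[of _ b])
next
  case False
  have "inverse (x powi a) = x powi (- a)"
    by (rule ratfun_pi_inverse_unique) (rule unit_powi_minus[OF assms])
  then show ?thesis
    using False unit_powi_mult[OF assms, of "- a" "nat (- b)"] by (simp add: power_int_def[of _ b])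
qed

lemma unit_powi_distrib:
  fixes x y :: ratfun_pi
  assumes "x dvd 1" "y dvd 1"
  shows "(x * y) powi a = x powi a * y powi a"
  by (simp add: power_int_def unit_inverse_mult[OF assms] power_mult_distrib)

lemma q_elt_unit: "q_elt dvd 1"
  by (metis q_elt_inverse dvdI)

lemma q_power_minus_one_unit:
  assumes "n > 0"
  shows "q_elt ^ n - 1 dvd 1"
proof -
  have mult: "ratfun_pi_of a * ratfun_pi_of b = ratfun_pi_of (a * b)" for a b
    by (simp add: ratfun_pi_of_def times_ratfun_pi.abs_eq mult.commute)
  have one: "ratfun_pi_of 1 = 1"
    by (simp add: ratfun_pi_of_def one_ratfun_pi_def one_pCons)
  have "q_elt ^ n = ratfun_pi_of (Fract [:0, 1:] 1 ^ n)" for n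
    by (induction n) (simp_all add: one mult q_elt_def)
  then have eq: "q_elt ^ n - 1 = ratfun_pi_of (Fract [:0, 1:] 1 ^ n - 1)"
    by (simp add: one[symmetric]) (simp add: ratfun_pi_of_def minus_ratfun_pi.abs_eq)
  have pw: "Fract [:0, 1:] 1 ^ k = (Fract (monom 1 k) 1 :: ratfun)" for k
    by (induction k) (simp_all add: One_fract_def monom_Suc monom_0 one_pCons)
  have "Fract [:0, 1:] 1 ^ n \<noteq> (1 :: ratfun)"
  proof
    assume "Fract [:0, 1:] 1 ^ n = (1 :: ratfun)"
    then have "monom (1 :: rat) n = 1"
      by (simp add: pw One_fract_def eq_fract)
    then have "degree (monom (1 :: rat) n) = 0" by simp
    then show False using assms by (simp add: degree_monom_eq)
  qed
  then have "ratfun_pi_of (Fract [:0, 1:] 1 ^ n - 1) *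
      ratfun_pi_of (inverse (Fract [:0, 1:] 1 ^ n - 1)) = 1"
    by (simp add: mult one)
  then show ?thesis unfolding eq by (metis dvdI)
qed

text \<open>
  The ground ring has zero divisors, so a nonzero element need not be invertible. Here
  \<open>\<pi>\<^sup>kq\<^sup>n - 1\<close> divides \<open>(\<pi>\<^sup>kq\<^sup>n)\<^sup>2 - 1 = q\<^sup>2\<^sup>n - 1\<close>, which lies in the field \<open>\<rat>(q)\<close> and is nonzero.
\<close>

lemma pi_q_power_minus_one_unit:
  assumes "n > 0"
  shows "pi_elt ^ k * q_elt ^ n - 1 dvd 1"
proof -
  have pi2: "pi_elt ^ k * pi_elt ^ k = 1"
    by (simp add: power_mult_distrib[symmetric] pi_elt_square)
  have "(pi_elt ^ k * q_elt ^ n - 1) * (pi_elt ^ k * q_elt ^ n + 1)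
      = (pi_elt ^ k * pi_elt ^ k) * (q_elt ^ n * q_elt ^ n) - 1"
    by (simp add: algebra_simps)
  also have "\<dots> = q_elt ^ (n + n) - 1" by (simp add: pi2 power_add)
  finally have "pi_elt ^ k * q_elt ^ n - 1 dvd q_elt ^ (n + n) - 1" by (metis dvdI)
  then show ?thesis using q_power_minus_one_unit[of "n + n"] assms dvd_trans by blast
qed

section \<open>Skew derivations\<close>

definition comm_factor :: "'i cartan_data \<Rightarrow> 'i \<Rightarrow> 'i \<Rightarrow> ratfun_pi" where
  "comm_factor C i j = q_elt powi cdot C i j * pi_elt ^ (parity C i * parity C j)"

text \<open>
  The factor \<open>q\<^bsup>i\<cdot>|w|\<^esup> \<pi>\<^bsup>p(i)p(|w|)\<^esup>\<close> by which \<open>\<theta>\<^sub>i\<close> moves past \<open>w\<close>, as a product over letters.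
\<close>

definition word_factor :: "'i cartan_data \<Rightarrow> 'i \<Rightarrow> 'i list \<Rightarrow> ratfun_pi" where
  "word_factor C i w = (\<Prod>j\<leftarrow>w. comm_factor C i j)"

lemma word_factor_eq: "word_factor C i w =
   q_elt powi word_dot C (Word [i]) (Word w) * pi_elt ^ (word_parity C (Word [i]) *
       word_parity C (Word w))"
proof (induction w)
  case Nil
  then show ?case by (simp add: word_factor_def word_dot_def word_parity_def)
next
  case (Cons j w)
  then show ?case
    by (simp add: word_factor_def word_dot_def word_parity_def comm_factor_def
      unit_powi_add[OF q_elt_unit] power_add distrib_left)
qed

lemma word_factor_perm: "mset u = mset v \<Longrightarrow> word_factor C i u = word_factor C i v"
  unfolding word_factor_def by (metis mset_map prod_mset_prod_list)

abbreviation basis_word :: "'i list \<Rightarrow> 'i free_alg" where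
  "basis_word w \<equiv> Poly_Mapping.single (Word w) 1"

lemma gen_mult_basis_word: "gen j * basis_word w = basis_word (j # w)"
  by (simp add: gen_def mult_single plus_word_def)

lemma basis_word_mult: "basis_word u * basis_word v = basis_word (u @ v)"
  by (simp add: mult_single plus_word_def)

lemma basis_word_Nil: "basis_word [] = 1"
  by (simp add: zero_word_def[symmetric])

lemma hom_eq_on_words:
  assumes "Modules.module_hom scale s f" "Modules.module_hom scale s g" "\<And>w. f (basis_word w) =
      g (basis_word w)"
  shows "f x = g x"
proof (rule hom_eq_on_basis[OF assms(1,2)])
  fix w show "f (Poly_Mapping.single w 1) = g (Poly_Mapping.single w 1)"
    using assms(3) by (cases w) simp
qed

primrec skew_der_word :: "'i cartan_data \<Rightarrow> 'i \<Rightarrow> 'i list \<Rightarrow> 'i free_alg" where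
  "skew_der_word C k [] = 0"
| "skew_der_word C k (j # w) = (if k = j then basis_word w else 0)
      + scale (comm_factor C k j) (gen j * skew_der_word C k w)"

text \<open>
  Lusztig's left skew derivation: the part of the coproduct of \<open>x\<close> of the form \<open>\<theta>\<^sub>k \<otimes> _\<close> is
  \<open>\<theta>\<^sub>k \<otimes> skew_der C k x\<close>.
\<close>

definition skew_der :: "'i cartan_data \<Rightarrow> 'i \<Rightarrow> 'i free_alg \<Rightarrow> 'i free_alg" where
  "skew_der C k = lin scale (\<lambda>w. skew_der_word C k (letters w))"

lemma skew_der_hom: "linear_map (skew_der C k)"
  unfolding skew_der_def by (rule lin_free_hom)

lemmas skew_der_homs = hom_comp[OF skew_der_hom]

lemma skew_der_basis_word: "skew_der C k (basis_word w) = skew_der_word C k w"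
  by (simp add: skew_der_def lin_free_single)

lemma skew_der_one: "skew_der C k 1 = 0"
  using skew_der_basis_word[of C k "[]"] by (simp add: basis_word_Nil)

lemma skew_der_gen_mult:
  "skew_der C k (gen j * x) = (if k = j then x else 0)
     + scale (comm_factor C k j) (gen j * skew_der C k x)"
proof (rule hom_eq_on_words[where s = scale and x = x])
  show "linear_map (\<lambda>x. skew_der C k (gen j * x))"
    by (intro skew_der_homs homs)
  show "linear_map (\<lambda>x. (if k = j then x else 0) + scale (comm_factor C k j) (gen j *
      skew_der C k x))"
    by (intro homs skew_der_homs)
qed (simp add: gen_mult_basis_word skew_der_basis_word)

lemma skew_der_word_mult:
  "skew_der C k (basis_word u * x) = skew_der C k (basis_word u) * x
     + scale (word_factor C k u) (basis_word u * skew_der C k x)"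
proof (induction u)
  case Nil
  then show ?case by (simp add: basis_word_Nil skew_der_one word_factor_def)
next
  case (Cons j u)
  show ?case
    unfolding gen_mult_basis_word[symmetric] mult.assoc skew_der_gen_mult Cons.IH
    by (simp add: algebra_simps scale_mult_left scale_mult_right word_factor_def
      free_mod.scale_right_distrib)
qed

lemma keys_scale: "Poly_Mapping.keys (scale c x) \<subseteq> Poly_Mapping.keys x"
  by (auto simp: in_keys_iff lookup_scale)

text \<open>
  Homogeneity, with weights recorded as multisets of letters; it is the reason why words of
  different weight are orthogonal.
\<close>

lemma keys_skew_der_word:
  "v \<in> Poly_Mapping.keys (skew_der_word C k w) \<Longrightarrow> mset w = add_mset k (mset (letters v))"
proof (induction w arbitrary: v)
  case (Cons j w)
  have "Poly_Mapping.keys (skew_der_word C k (j # w)) \<subseteq>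
      Poly_Mapping.keys (if k = j then basis_word w else 0)
      \<union> Poly_Mapping.keys (gen j * skew_der_word C k w)"
    unfolding skew_der_word.simps by (rule order.trans[OF keys_add Un_mono[OF order.refl
        keys_scale]])
  with Cons.prems have "v \<in> Poly_Mapping.keys (if k = j then basis_word w else 0)
      \<union> Poly_Mapping.keys (gen j * skew_der_word C k w)"
    by blast
  then consider "k = j" "v = Word w" | "v \<in> Poly_Mapping.keys (gen j * skew_der_word C k w)"
    by (auto split: if_splits)
  then show ?case
  proof cases
    case 2
    then obtain v' where "v' \<in> Poly_Mapping.keys (skew_der_word C k w)" "v = Word [j] + v'"
      using keys_mult[of "gen j" "skew_der_word C k w"] by (auto simp: gen_def)
    then show ?thesis using Cons.IH by (simp add: plus_word_def)
  qed simp
qed simp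

section \<open>The bilinear form\<close>

definition form_const :: "'i cartan_data \<Rightarrow> 'i \<Rightarrow> ratfun_pi" where
  "form_const C i = inverse (1 - pi_i C i * q_i C i powi (- 2))"

text \<open>
  The recursion is forced by the axioms: pairing \<open>\<theta>\<^sub>i u\<close> with \<open>y\<close> means pairing \<open>\<theta>\<^sub>i \<otimes> u\<close> with the
  coproduct of \<open>y\<close>, and \<open>\<theta>\<^sub>i\<close> pairs only with \<open>\<theta>\<^sub>i\<close>.
\<close>

primrec form_word :: "'i cartan_data \<Rightarrow> 'i list \<Rightarrow> 'i free_alg \<Rightarrow> ratfun_pi" where
  "form_word C [] y = Poly_Mapping.lookup y 0"
| "form_word C (i # u) y = form_const C i * form_word C u (skew_der C i y)"

definition form :: "'i cartan_data \<Rightarrow> 'i free_alg \<Rightarrow> 'i free_alg \<Rightarrow> ratfun_pi" where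
  "form C x y = lin (*) (\<lambda>u. form_word C (letters u) y) x"

lemma form_hom_left: "linear_functional (\<lambda>x. form C x y)"
  unfolding form_def by (rule lin_scalar_hom)

lemma form_word_hom: "linear_functional (form_word C u)"
proof (induction u)
  case Nil
  have "form_word C [] = (\<lambda>y. Poly_Mapping.lookup y 0)" by (simp add: fun_eq_iff)
  then show ?case by (simp add: hom_coeff)
next
  case (Cons i u)
  have "form_word C (i # u) = (\<lambda>y. form_const C i * form_word C u (skew_der C i y))"
    by (simp add: fun_eq_iff)
  then show ?case using Cons.IH by (auto intro!: homs hom_comp[OF Cons.IH] skew_der_hom)
qed

lemma form_hom_right: "linear_functional (\<lambda>y. form C x y)"
  unfolding form_def
  by (rule hom_lin_pointwise[OF free_mod.module_axioms scalar_module form_word_hom])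

lemma form_basis_word: "form C (basis_word u) y = form_word C u y"
  by (simp add: form_def lin_scalar_single)

lemmas form_homs = hom_comp[OF form_hom_left] hom_comp[OF form_hom_right]

lemma form_one_left: "form C 1 y = Poly_Mapping.lookup y 0"
  using form_basis_word[of C "[]" y] by (simp add: basis_word_Nil)

lemma form_gen_mult_left: "form C (gen i * x) y = form_const C i * form C x (skew_der C i y)"
  by (rule hom_eq_on_words[where s = "(*)" and x = x])
    (intro form_homs homs form_hom_left | simp add: gen_mult_basis_word form_basis_word)+

lemma form_zero: "form C 0 y = 0" "form C x 0 = 0"
  using Modules.module_hom.zero[OF form_hom_left] Modules.module_hom.zero[OF form_hom_right]
      by blast+

lemma form_add: "form C (x + x') y = form C x y + form C x' y" "form C x (y + y') =
    form C x y + form C x y'"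
  using form_hom_left[of C y] form_hom_right[of C x] by (auto simp: Modules.module_hom_iff)

lemma form_scale: "form C (scale c x) y = c * form C x y" "form C x (scale c y) = c * form C x y"
  using form_hom_left[of C y] form_hom_right[of C x] by (auto simp: Modules.module_hom_iff)

lemma lookup_gen_mult_zero: "Poly_Mapping.lookup (gen i * x) 0 = 0"
  by (rule hom_eq_on_words[where s = "(*)" and x = x])
    (intro hom_comp[OF hom_coeff] homs zero_hom | simp add: gen_mult_basis_word lookup_single
        zero_word_def)+

lemma form_one_right: "form C x 1 = Poly_Mapping.lookup x 0"
proof (rule hom_eq_on_words[where s = "(*)" and x = x])
  fix w show "form C (basis_word w) 1 = Poly_Mapping.lookup (basis_word w) 0"
  proof (cases w)
    case Nil
    then show ?thesis by (simp add: basis_word_Nil form_one_left)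
  next
    case (Cons i u)
    then show ?thesis
      by (simp add: gen_mult_basis_word[symmetric] form_gen_mult_left skew_der_one form_zero
          lookup_gen_mult_zero)
  qed
qed (intro form_hom_left hom_coeff)+

lemma comm_factor_sym:
  assumes "super_cartan_datum C"
  shows "comm_factor C i j = comm_factor C j i"
  using assms by (simp add: comm_factor_def super_cartan_datum_def mult.commute)

text \<open>
  Left multiplication by \<open>\<theta>\<^sub>i\<close> is adjoint to the skew derivation on the other side too. Expanding
  both sides for a left argument \<open>\<theta>\<^sub>j u\<close> gives the same two terms, up to the order of \<open>i\<close> and \<open>j\<close> in
  the commutation factor, which is symmetric. Symmetry of the form follows by induction.
\<close>

lemma form_gen_mult_right:
  assumes "super_cartan_datum C"
  shows "form C x (gen i * y) = form_const C i * form C (skew_der C i x) y"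
proof -
  have "form C (basis_word u) (gen i * y) = form_const C i *
      form C (skew_der C i (basis_word u)) y" for u y
  proof (induction u arbitrary: y)
    case Nil
    then show ?case by (simp add: basis_word_Nil form_one_left lookup_gen_mult_zero
        skew_der_one form_zero)
  next
    case (Cons j u)
    show ?case
      unfolding gen_mult_basis_word[symmetric] form_gen_mult_left skew_der_gen_mult form_add
          form_scale Cons.IH
      by (simp add: comm_factor_sym[OF assms, of i j] form_zero algebra_simps)
  qed
  then show ?thesis
    by (intro hom_eq_on_words[where s = "(*)" and x = x and f = "\<lambda>x. form C x (gen i * y)"
       and g = "\<lambda>x. form_const C i * form C (skew_der C i x) y"]
           form_hom_left homs form_homs skew_der_hom)
qed

lemma form_sym:
  assumes "super_cartan_datum C"
  shows "form C x y = form C y x"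
proof -
  have "form C (basis_word u) y = form C y (basis_word u)" for u y
    by (induction u arbitrary: y)
      (simp_all add: basis_word_Nil form_one_left form_one_right gen_mult_basis_word[symmetric]
         form_gen_mult_left form_gen_mult_right[OF assms])
  then show ?thesis
    by (intro hom_eq_on_words[where s = "(*)" and x = x and f = "\<lambda>x. form C x y"
       and g = "\<lambda>x. form C y x"] form_hom_left form_hom_right)
qed

lemma form_weight_orthogonal: "mset u \<noteq> mset v \<Longrightarrow> form C (basis_word u) (basis_word v) = 0"
proof (induction u arbitrary: v)
  case Nil
  then show ?case by (auto simp: basis_word_Nil form_one_left lookup_single zero_word_def when_def)
next
  case (Cons i u)
  have "form C (basis_word u) (skew_der_word C i v) = (\<Sum>w\<in>Poly_Mapping.keys (skew_der_word C i v).
     Poly_Mapping.lookup (skew_der_word C i v) w * form C (basis_word u) (Poly_Mapping.single w 1))"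
    by (subst sum_basis) (simp add: Modules.module_hom.sum[OF form_hom_right] form_scale)
  also have "\<dots> = 0"
  proof (rule sum.neutral, rule ballI)
    fix w assume "w \<in> Poly_Mapping.keys (skew_der_word C i v)"
    then have "mset u \<noteq> mset (letters w)"
      using keys_skew_der_word Cons.prems by fastforce
    then show "Poly_Mapping.lookup (skew_der_word C i v) w *
        form C (basis_word u) (Poly_Mapping.single w 1) = 0"
      using Cons.IH[of "letters w"] by simp
  qed
  finally show ?case
    by (simp add: gen_mult_basis_word[symmetric] form_gen_mult_left) (simp add:
        gen_mult_basis_word skew_der_basis_word)
qed

section \<open>Lusztig's form and its radical\<close>

lemma tensor_form_tensor:
  assumes "\<And>y. linear_functional (\<lambda>x. B x y)"
  shows "tensor_form B (tensor x x') (Poly_Mapping.single (v1, v2) 1) =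
     B x (Poly_Mapping.single v1 1) * B x' (Poly_Mapping.single v2 1)"
proof -
  have "tensor_form B (tensor (Poly_Mapping.single u1 1) x') (Poly_Mapping.single (v1, v2) 1) =
     B (Poly_Mapping.single u1 1) (Poly_Mapping.single v1 1) *
         B x' (Poly_Mapping.single v2 1)" for u1
    by (rule hom_eq_on_basis[where s = "(*)" and x = x'])
      (intro hom_comp[OF tensor_form_hom_left] tensor_hom_right homs assms
        | simp add: tensor_form_single)+
  then show ?thesis
    by (intro hom_eq_on_basis[where s = "(*)" and x = x and g = "\<lambda>x. B x _ * _"
         and f = "\<lambda>x. tensor_form B (tensor x x') (Poly_Mapping.single (v1, v2) 1)"]
       hom_comp[OF tensor_form_hom_left] tensor_hom_left homs assms)
qed

text \<open>
  The operator by which the coproduct of \<open>\<theta>\<^sub>j v\<close> is obtained from that of \<open>v\<close>.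
\<close>

lemma tensor_mult_gen:
  "tensor_mult C (tensor (gen j) 1 + tensor 1 (gen j)) (Poly_Mapping.single (Word v1, Word v2) 1) =
     Poly_Mapping.single (Word (j # v1), Word v2) 1
     + scale (word_factor C j v1) (Poly_Mapping.single (Word v1, Word (j # v2)) 1)"
proof -
  have one: "1 = Poly_Mapping.single (Word []) (1 :: ratfun_pi)"
    by (simp add: zero_word_def[symmetric])
  show ?thesis
    unfolding word_factor_eq one gen_def tensor_single Modules.module_hom.add[OF
        tensor_mult_hom_left]
    by (simp add: tensor_mult_single scale_single plus_word_def word_dot_def word_parity_def)
qed

lemma coprod_word_Cons: "coprod_word C (Word (j # v)) =
    tensor_mult C (tensor (gen j) 1 + tensor 1 (gen j)) (coprod_word C (Word v))"
  by (simp add: coprod_word_def)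

lemma coprod_one: "coprod_word C (Word []) = Poly_Mapping.single (0, 0) 1"
  by (simp add: coprod_word_def flip: single_one)

text \<open>
  The factor depends on the weight only, and words of different weight are orthogonal.
\<close>

lemma form_word_factor:
  "word_factor C i v * form C (basis_word u) (basis_word v) =
      word_factor C i u * form C (basis_word u) (basis_word v)"
  using form_weight_orthogonal[of u v C] word_factor_perm[of u v C i] by (cases "mset u =
      mset v") auto

text \<open>
  Induction on the length of a word \<open>y\<close>. Removing its first letter \<open>j\<close> on the left-hand side
  amounts to applying the skew derivation along \<open>j\<close> to \<open>x * x'\<close>, where the twisted Leibniz rule
  yields two terms. On the right-hand side the summands \<open>\<theta>\<^sub>j \<otimes> 1\<close> and \<open>1 \<otimes> \<theta>\<^sub>j\<close> yield the same two:
  their commutation factors depend on the weight of \<open>x\<close> and on that of its pairing partner, and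
  by orthogonality only equal weights contribute.
\<close>

lemma form_mult_left:
  assumes "super_cartan_datum C"
  shows "form C (x * x') y = tensor_form (form C) (tensor x x') (coprod C y)"
proof -
  let ?F = "tensor_form (form C)"
  let ?L = "\<lambda>j. tensor_mult C (tensor (gen j) 1 + tensor 1 (gen j))"
  \<comment> \<open>The first argument has to be a word, because the commutation factor refers to its weight.\<close>
  have adjoint: "?F (tensor (basis_word u) (basis_word u')) (?L j T) =
      form_const C j * (?F (tensor (skew_der C j (basis_word u)) (basis_word u')) T
        + word_factor C j u * ?F (tensor (basis_word u) (skew_der C j (basis_word u'))) T)"
            for u u' j T
  proof (rule hom_eq_on_basis[where s = "(*)" and x = T])
    fix w :: "'a word \<times> 'a word"
    obtain v1 v2 where w: "w = (Word v1, Word v2)" by (metis surj_pair word.exhaust)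
    have "?F (tensor (basis_word u) (basis_word u')) (?L j (Poly_Mapping.single w 1)) =
       form C (basis_word u) (basis_word (j # v1)) * form C (basis_word u') (basis_word v2)
       + word_factor C j v1 * (form C (basis_word u) (basis_word v1) *
           form C (basis_word u') (basis_word (j # v2)))"
      unfolding w tensor_mult_gen Modules.module_hom.add[OF tensor_form_hom_right]
        Modules.module_hom.scale[OF tensor_form_hom_right] tensor_form_tensor[OF form_hom_left] ..
    also have "\<dots> = form C (basis_word u) (gen j * basis_word v1) *
        form C (basis_word u') (basis_word v2)
       + (word_factor C j v1 * form C (basis_word u) (basis_word v1)) *
           form C (basis_word u') (gen j * basis_word v2)"
      by (simp only: gen_mult_basis_word mult.assoc)
    also have "\<dots> = form_const C j * (form C (skew_der C j (basis_word u)) (basis_word v1) *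
        form C (basis_word u') (basis_word v2)
       + word_factor C j u * (form C (basis_word u) (basis_word v1) *
           form C (skew_der C j (basis_word u')) (basis_word v2)))"
      by (simp only: form_word_factor form_gen_mult_right[OF assms]
          distrib_left mult.assoc mult.left_commute)
    finally show "?F (tensor (basis_word u) (basis_word u')) (?L j (Poly_Mapping.single w 1)) =
      form_const C j * (?F (tensor (skew_der C j (basis_word u)) (basis_word u'))
          (Poly_Mapping.single w 1)
        + word_factor C j u * ?F (tensor (basis_word u) (skew_der C j (basis_word u')))
            (Poly_Mapping.single w 1))"
      unfolding w tensor_form_tensor[OF form_hom_left] .
  qed (intro homs hom_comp[OF tensor_form_hom_right] tensor_mult_hom_right tensor_form_hom_right)+
  have "form C (x * x') (basis_word v) = ?F (tensor x x') (coprod_word C (Word v))" for v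
  proof (induction v arbitrary: x x')
    case Nil
    have "Poly_Mapping.lookup (x * x') 0 = Poly_Mapping.lookup x 0 *
        Poly_Mapping.lookup x' (0 :: 'a word)"
    proof (rule hom_eq_on_words[where s = "(*)" and x = x])
      fix u
      show "Poly_Mapping.lookup (basis_word u * x') 0 =
          Poly_Mapping.lookup (basis_word u) 0 * Poly_Mapping.lookup x' 0"
        by (cases u) (simp_all add: basis_word_Nil gen_mult_basis_word[symmetric]
            mult.assoc lookup_gen_mult_zero)
    qed (intro homs hom_comp[OF hom_coeff] hom_coeff)+
    then show ?case
      by (simp add: coprod_one tensor_form_tensor[OF form_hom_left] basis_word_Nil form_one_right)
  next
    case (Cons j v)
    have "form C (basis_word u * basis_word u') (basis_word (j # v)) =
        ?F (tensor (basis_word u) (basis_word u')) (coprod_word C (Word (j # v)))" for u u'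
      unfolding gen_mult_basis_word[symmetric] form_gen_mult_right[OF assms]
          coprod_word_Cons adjoint
        skew_der_word_mult form_add form_scale Cons.IH ..
    then have "form C (basis_word u * x') (basis_word (j # v)) =
        ?F (tensor (basis_word u) x') (coprod_word C (Word (j # v)))" for u
      by (intro hom_eq_on_words[where s = "(*)" and x = x' and f =
          "\<lambda>x'. form C (basis_word u * x') (basis_word (j # v))"
         and g = "\<lambda>x'. ?F (tensor (basis_word u) x') (coprod_word C (Word (j # v)))"]
         form_homs homs hom_comp[OF tensor_form_hom_left] tensor_hom_right)
    then show ?case
      by (intro hom_eq_on_words[where s = "(*)" and x = x and f =
          "\<lambda>x. form C (x * x') (basis_word (j # v))"
         and g = "\<lambda>x. ?F (tensor x x') (coprod_word C (Word (j # v)))"]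
         form_homs homs hom_comp[OF tensor_form_hom_left] tensor_hom_left)
  qed
  then show ?thesis
    by (intro hom_eq_on_words[where s = "(*)" and x = y and f = "\<lambda>y. form C (x * x') y"
         and g = "\<lambda>y. ?F (tensor x x') (coprod C y)"]
         form_hom_right hom_comp[OF tensor_form_hom_right] coprod_hom) (simp add: coprod_single)
qed

lemma tensor_form_sym:
  assumes "\<And>x y. B x y = B y x"
  shows "tensor_form B S T = tensor_form B T S"
proof -
  have basis: "tensor_form B (Poly_Mapping.single w 1) (Poly_Mapping.single w' 1) =
      tensor_form B (Poly_Mapping.single w' 1) (Poly_Mapping.single w 1)" for w w'
    using assms[of "Poly_Mapping.single (fst w) 1" "Poly_Mapping.single (fst w') 1"]
      assms[of "Poly_Mapping.single (snd w) 1" "Poly_Mapping.single (snd w') 1"]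
    by (cases w; cases w') (simp only: tensor_form_single fst_conv snd_conv)
  have "tensor_form B (Poly_Mapping.single w 1) T = tensor_form B T (Poly_Mapping.single w 1)" for w
    by (rule hom_eq_on_basis[where s = "(*)" and x = T])
      (rule tensor_form_hom_left tensor_form_hom_right basis)+
  then show ?thesis
    by (intro hom_eq_on_basis[where s = "(*)" and x = S and f = "\<lambda>S. tensor_form B S T" and g =
        "tensor_form B T"]
       tensor_form_hom_left tensor_form_hom_right)
qed

lemma form_is_lusztig_form:
  assumes "super_cartan_datum C"
  shows "is_lusztig_form C (form C)"
proof -
  have gen: "gen i = gen i * 1" for i :: 'a by simp
  have "form C (gen i) (gen j) = (if i = j then form_const C i else 0)" for i j
    by (subst gen, subst (2) gen)
      (simp del: mult_1_right add: form_gen_mult_left skew_der_gen_mult skew_der_one,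
       simp add: form_one_left form_zero)
  moreover have "form C x (y * y') = tensor_form (form C) (coprod C x) (tensor y y')" for x y y'
    using form_sym[OF assms] form_mult_left[OF assms] tensor_form_sym by metis
  ultimately show ?thesis
    unfolding is_lusztig_form_def
    by (simp add: form_add form_scale form_one_left form_mult_left[OF assms] form_const_def)
qed

lemma tensor_form_tensor_right:
  assumes "\<And>x. linear_functional (B x)"
  shows "tensor_form B (Poly_Mapping.single (u1, u2) 1) (tensor y y') =
     B (Poly_Mapping.single u1 1) y * B (Poly_Mapping.single u2 1) y'"
proof -
  have "tensor_form B (Poly_Mapping.single (u1, u2) 1) (tensor (Poly_Mapping.single v1 1) y') =
     B (Poly_Mapping.single u1 1) (Poly_Mapping.single v1 1) *
         B (Poly_Mapping.single u2 1) y'" for v1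
    by (rule hom_eq_on_basis[where s = "(*)" and x = y'])
      (intro hom_comp[OF tensor_form_hom_right] tensor_hom_right homs assms
        | simp add: tensor_form_single)+
  then show ?thesis
    by (intro hom_eq_on_basis[where s = "(*)" and x = y and g = "\<lambda>y. B _ y * _"
         and f = "\<lambda>y. tensor_form B (Poly_Mapping.single (u1, u2) 1) (tensor y y')"]
       hom_comp[OF tensor_form_hom_right] tensor_hom_left homs assms)
qed

text \<open>
  The two rules for products, applied to \<open>1 = 1 \<cdot> 1\<close> and to words, determine the pairings of
  \<open>1\<close> and of \<open>\<theta>\<^sub>i\<close> with all words. The rule for \<open>\<theta>\<^sub>i u\<close> then reduces the pairing of longer words to that of
  shorter ones.
\<close>

lemma lusztig_form_unique:
  assumes "is_lusztig_form C B" "is_lusztig_form C B'"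
  shows "B = B'"
proof -
  have hom_left: "linear_functional (\<lambda>x. B x y)" and hom_right: "linear_functional (B x)"
    if "is_lusztig_form C B" for B x y
    using that
    by (simp_all add: is_lusztig_form_def Modules.module_hom_iff free_mod.module_axioms
        scalar_module)
  have left: "B (x * x') y = tensor_form B (tensor x x') (coprod C y)"
    if "is_lusztig_form C B" for B x x' y
    using that by (simp add: is_lusztig_form_def)
  have co1: "coprod C 1 = Poly_Mapping.single (0, 0) 1"
    using coprod_single[of C "Word []"] coprod_one[of C] by (simp add: basis_word_Nil)
  have cogen: "coprod C (gen i) = Poly_Mapping.single (Word [i], 0) 1 +
      Poly_Mapping.single (0, Word [i]) 1" for i
    using coprod_single[of C "Word [i]"] tensor_mult_gen[of C i "[]" "[]"]
    by (simp add: coprod_word_Cons coprod_one gen_def zero_word_def word_factor_def)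
  have small: "B 1 (basis_word v) = (if v = [] then 1 else 0)"
      "B (gen i) (basis_word v) = (if v = [i] then form_const C i else 0)"
    if B: "is_lusztig_form C B" for B i v
  proof -
    have one: "B 1 1 = 1" and gens: "\<And>i j. B (gen i) (gen j) = (if i =
        j then form_const C i else 0)"
      and right: "\<And>x y y'. B x (y * y') = tensor_form B (coprod C x) (tensor y y')"
      using B by (simp_all add: is_lusztig_form_def form_const_def)
    have one_mult: "B 1 (y * y') = B 1 y * B 1 y'" for y y'
      by (simp add: right co1 tensor_form_tensor_right[OF hom_right[OF B]])
    have gen_mult: "B (gen i) (y * y') = B (gen i) y * B 1 y' + B 1 y * B (gen i) y'" for i y y'
      unfolding right cogen Modules.module_hom.add[OF tensor_form_hom_left]
        tensor_form_tensor_right[OF hom_right[OF B]] by (simp add: gen_def)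
    have gen_one: "B (gen i) 1 = 0" for i
      using gen_mult[of i 1 1] by (simp add: one)
    have one_gen: "B 1 (gen i) = 0" for i
      using left[OF B, of 1 1 "gen i"]
      unfolding cogen Modules.module_hom.add[OF tensor_form_hom_right]
        tensor_form_tensor[OF hom_left[OF B]] by (simp add: gen_def one)
    show B1: "B 1 (basis_word v) = (if v = [] then 1 else 0)" for v
      by (cases v) (simp_all add: basis_word_Nil gen_mult_basis_word[symmetric]
          one one_mult one_gen)
    show "B (gen i) (basis_word v) = (if v = [i] then form_const C i else 0)"
    proof (cases v)
      case (Cons j v')
      show ?thesis
        unfolding Cons gen_mult_basis_word[symmetric] gen_mult B1 gens one_gen by simp
    qed (simp add: basis_word_Nil gen_one)
  qed
  have "B (basis_word u) y = B' (basis_word u) y" for u y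
  proof (induction u arbitrary: y)
    case Nil
    show ?case
      by (rule hom_eq_on_words[where s = "(*)" and x = y])
        (simp_all add: basis_word_Nil hom_right assms small(1)[OF assms(1)] small(1)[OF assms(2)])
  next
    case (Cons i u)
    have "tensor_form B (tensor (gen i) (basis_word u)) T =
        tensor_form B' (tensor (gen i) (basis_word u)) T" for T
    proof (rule hom_eq_on_basis[where s = "(*)" and x = T])
      fix w :: "'a word \<times> 'a word"
      obtain v1 v2 where "w = (Word v1, Word v2)" by (metis surj_pair word.exhaust)
      then show "tensor_form B (tensor (gen i) (basis_word u)) (Poly_Mapping.single w 1) =
          tensor_form B' (tensor (gen i) (basis_word u)) (Poly_Mapping.single w 1)"
        by (simp add: tensor_form_tensor hom_left assms small(2)[OF assms(1)]
            small(2)[OF assms(2)] Cons.IH)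
    qed (rule tensor_form_hom_right)+
    then show ?case
      by (simp add: gen_mult_basis_word[symmetric] left assms)
  qed
  then have "B x y = B' x y" for x y
    by (intro hom_eq_on_words[where s = "(*)" and x = x and f = "\<lambda>x. B x y" and g = "\<lambda>x. B' x y"]
        hom_left assms)
  then show ?thesis by blast
qed

lemma lusztig_form_eq:
  assumes "super_cartan_datum C"
  shows "lusztig_form C = form C"
  unfolding lusztig_form_def
  using form_is_lusztig_form[OF assms] lusztig_form_unique by blast

text \<open>
  The criterion by which all relations below are recognised: a product \<open>\<theta>\<^sub>k y\<close> on the right moves to
  the skew derivation along \<open>k\<close> on the left.
\<close>

lemma in_radicalI:
  assumes C: "super_cartan_datum C" and "Poly_Mapping.lookup x 0 = 0"
    and "\<And>k. skew_der C k x \<in> form_radical C"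
  shows "x \<in> form_radical C"
proof -
  have "form C x (basis_word v) = 0" for v
    using assms by (cases v) (simp_all add: basis_word_Nil form_one_right
        gen_mult_basis_word[symmetric]
      form_gen_mult_right[OF C] form_radical_def lusztig_form_eq[OF C])
  then have "form C x y = 0" for y
    by (intro hom_eq_on_words[where s = "(*)" and x = y and f = "form C x" and g = "\<lambda>y. 0"]
       form_hom_right zero_hom)
  then show ?thesis by (simp add: form_radical_def lusztig_form_eq[OF C])
qed

lemma radical_zero: "super_cartan_datum C \<Longrightarrow> 0 \<in> form_radical C"
  by (simp add: form_radical_def lusztig_form_eq form_zero)

lemma radical_scale: "super_cartan_datum C \<Longrightarrow> x \<in> form_radical C \<Longrightarrow> scale c x \<in> form_radical C"
  by (simp add: form_radical_def lusztig_form_eq form_scale)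

section \<open>Quantum integers and divided powers\<close>

lemma q_i_unit: "q_i C i dvd 1"
  unfolding q_i_def by (metis unit_powi_minus[OF q_elt_unit] dvdI)

lemma pi_i_square: "pi_i C i * pi_i C i = 1"
  by (simp add: pi_i_def power_mult_distrib[symmetric] pi_elt_square)

lemma pi_i_unit: "pi_i C i dvd 1"
  by (metis pi_i_square dvdI)

lemma pi_q_unit: "pi_i C i * q_i C i dvd 1"
  using mult_dvd_mono[OF pi_i_unit q_i_unit] by simp

lemma parity_cases: "parity C i = 0 \<or> parity C i = 1"
  by (simp add: parity_def)

lemma q_i_square: 
  assumes "super_cartan_datum C"
  shows "q_elt powi cdot C i i = q_i C i ^ 2"
proof -
  have "cdot C i i = dd C i * 2"
    using assms by (simp add: super_cartan_datum_def dd_def)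
  then show ?thesis
    using unit_powi_mult[OF q_elt_unit, of "dd C i" 2] by (simp add: q_i_def)
qed

lemma comm_factor_self:
  assumes "super_cartan_datum C"
  shows "comm_factor C i i = pi_i C i * q_i C i ^ 2"
  using parity_cases[of C i] by (auto simp: comm_factor_def pi_i_def q_i_square[OF assms]
      mult.commute)

lemma comm_factor_self_minus_one_unit:
  assumes C: "super_cartan_datum C" and "r > 0"
  shows "comm_factor C i i ^ r - 1 dvd 1"
proof -
  have pos: "dd C i > 0" using C by (simp add: super_cartan_datum_def dd_def)
  then have q: "q_i C i = q_elt ^ nat (dd C i)" by (simp add: q_i_def power_int_def)
  have "comm_factor C i i ^ r = pi_elt ^ (parity C i * r) * q_elt ^ (nat (dd C i) * 2 * r)"
    unfolding comm_factor_self[OF C] q pi_i_def power_mult_distrib power_mult[symmetric] ..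
  moreover have "nat (dd C i) * 2 * r > 0" using pos assms(2) by simp
  ultimately show ?thesis using pi_q_power_minus_one_unit by metis
qed

text \<open>
  The \<open>i\<close>-th skew derivation of \<open>\<theta>\<^sub>i\<^sup>r\<^sup>+\<^sup>1\<close> produces the geometric sum; this is how quantum integers
  enter. The ratio of the sum to \<open>[r + 1]\<^sub>i\<close> is the power of \<open>q\<^sub>i\<close> in \<open>div_pow_der\<close>.
\<close>

lemma qnum_Suc:
  assumes C: "super_cartan_datum C"
  shows "q_i C i ^ r * qnum C i (Suc r) = (\<Sum>l<Suc r. comm_factor C i i ^ l)"
proof -
  define a where "a = q_i C i"
  define b where "b = inverse a"
  define p where "p = pi_i C i"
  define x where "x = comm_factor C i i"
  define D where "D = p * a - b"
  have ab: "a * b = 1" unfolding a_def b_def by (rule unit_mult_inverse[OF q_i_unit])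
  have x: "x = p * a * a" using comm_factor_self[OF C]
      by (simp add: x_def p_def a_def power2_eq_square mult.assoc)
  have aD: "a * D = x - 1" using ab by (simp add: D_def x algebra_simps)
  have "x - 1 dvd 1" using comm_factor_self_minus_one_unit[OF C, of 1 i] by (simp add: x_def)
  then have D: "D * inverse D = 1" using aD unit_mult_inverse dvd_trans dvd_triv_right by metis
  have "a ^ Suc r * ((p * a) ^ Suc r - b ^ Suc r) = x ^ Suc r - (a * b) ^ Suc r"
    unfolding x power_mult_distrib right_diff_distrib by (simp only: ac_simps)
  also have "\<dots> = (x - 1) * (\<Sum>l<Suc r. x ^ l)"
    unfolding ab using power_diff_1_eq[of x "Suc r"] by simp
  also have "\<dots> = a * (D * (\<Sum>l<Suc r. x ^ l))" unfolding aD[symmetric] mult.assoc ..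
  finally have "b * (a ^ Suc r * ((p * a) ^ Suc r - b ^ Suc r)) = b * (a * (D * (\<Sum>l<Suc r. x ^ l)))"
    by simp
  then have "(a * b) * (a ^ r * ((p * a) ^ Suc r - b ^ Suc r)) = (a * b) * (D * (\<Sum>l<Suc r. x ^ l))"
    by (simp only: power_Suc ac_simps)
  then have "a ^ r * ((p * a) ^ Suc r - b ^ Suc r) = D *
      (\<Sum>l<Suc r. x ^ l)" by (simp only: ab mult_1_left)
  then have "a ^ r * (((p * a) ^ Suc r - b ^ Suc r) * inverse D) =
      (D * inverse D) * (\<Sum>l<Suc r. x ^ l)"
    by (metis mult.assoc mult.commute)
  moreover have "qnum C i (Suc r) = ((p * a) ^ Suc r - b ^ Suc r) * inverse D"
    unfolding qnum_def divide_ratfun_pi_def D_def a_def[symmetric] p_def[symmetric] b_def[symmetric]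
    by (simp add: power_int_def b_def del: of_nat_Suc power_Suc)
  ultimately show ?thesis by (simp only: D a_def[symmetric] x_def[symmetric] mult_1_left)
qed

lemma qnum_unit:
  assumes C: "super_cartan_datum C"
  shows "qnum C i (Suc r) dvd 1"
proof -
  have h1: "qnum C i (Suc r) dvd (\<Sum>l<Suc r. comm_factor C i i ^ l)"
    using qnum_Suc[OF C, of i r] by (metis dvd_triv_right)
  have h2: "(\<Sum>l<Suc r. comm_factor C i i ^ l) dvd comm_factor C i i ^ Suc r - 1"
    using power_diff_1_eq[of "comm_factor C i i" "Suc r"] by (metis dvd_triv_right)
  show ?thesis
    by (rule dvd_trans[OF dvd_trans[OF h1 h2] comm_factor_self_minus_one_unit[OF C zero_less_Suc]])
qed

lemma qfact_unit:
  assumes C: "super_cartan_datum C"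
  shows "qfact C i r dvd 1"
proof (induction r)
  case (Suc r)
  then show ?case using mult_dvd_mono[OF Suc qnum_unit[OF C]] by (simp add: qfact_def mult.commute)
qed (simp add: qfact_def)

lemma inverse_qfact_Suc:
  assumes C: "super_cartan_datum C"
  shows "inverse (qfact C i (Suc r)) * (\<Sum>l<Suc r. comm_factor C i i ^ l) =
      q_i C i ^ r * inverse (qfact C i r)"
proof -
  have "qfact C i (Suc r) = qnum C i (Suc r) * qfact C i r" by (simp add: qfact_def mult.commute)
  then have "inverse (qfact C i (Suc r)) = inverse (qnum C i (Suc r)) * inverse (qfact C i r)"
    using unit_inverse_mult[OF qnum_unit[OF C] qfact_unit[OF C]] by simp
  then have "inverse (qfact C i (Suc r)) * (\<Sum>l<Suc r. comm_factor C i i ^ l) =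
     q_i C i ^ r * inverse (qfact C i r) * (qnum C i (Suc r) * inverse (qnum C i (Suc r)))"
    unfolding qnum_Suc[OF C, symmetric] by (simp only: ac_simps)
  then show ?thesis by (simp add: unit_mult_inverse[OF qnum_unit[OF C]])
qed

definition div_pow :: "'i cartan_data \<Rightarrow> 'i \<Rightarrow> nat \<Rightarrow> 'i free_alg" where
  "div_pow C i r = scale (inverse (qfact C i r)) (gen i ^ r)"

text \<open>
  The \<open>i\<close>-th skew derivative of \<open>\<theta>\<^sub>i\<^bsup>(r)\<^esup>\<close>, namely \<open>q\<^sub>i\<^bsup>r-1\<^esup> \<theta>\<^sub>i\<^bsup>(r-1)\<^esup>\<close>.
\<close>

definition div_pow_der :: "'i cartan_data \<Rightarrow> 'i \<Rightarrow> nat \<Rightarrow> 'i free_alg" where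
  "div_pow_der C i r = (case r of 0 \<Rightarrow> 0 | Suc r \<Rightarrow> scale (q_i C i ^ r) (div_pow C i r))"

lemma inverse_one: "inverse (1 :: ratfun_pi) = 1"
  by (rule ratfun_pi_inverse_unique) simp

lemma div_pow_0: "div_pow C i 0 = 1"
  by (simp add: div_pow_def qfact_def inverse_one)

lemma skew_der_gen_power:
  "skew_der C k (gen i ^ r * y) =
     (if k = i then scale (\<Sum>l<r. comm_factor C i i ^ l) (gen i ^ (r - 1) * y) else 0)
     + scale (comm_factor C k i ^ r) (gen i ^ r * skew_der C k y)"
proof (induction r)
  case (Suc r)
  have geom: "(\<Sum>l<Suc r. x ^ l) = 1 + x * (\<Sum>l<r. x ^ l)" for x :: ratfun_pi
    by (subst sum.lessThan_Suc_shift) (simp add: sum_distrib_left)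
  \<comment> \<open>For \<open>r = 0\<close> the sum is empty, so the truncated exponent \<open>r - 1\<close> is harmless.\<close>
  have pred: "scale (\<Sum>l<r. comm_factor C i i ^ l) (gen i * (gen i ^ (r - 1) * y))
      = scale (\<Sum>l<r. comm_factor C i i ^ l) (gen i ^ r * y)"
    by (cases r) (simp_all add: mult.assoc)
  show ?case
    unfolding power_Suc mult.assoc skew_der_gen_mult Suc.IH geom
    using pred
    by (auto simp: distrib_left scale_mult_right free_mod.scale_right_distrib
        free_mod.scale_left_distrib
        free_mod.scale_scale[symmetric] simp del: free_mod.scale_scale)
qed simp

lemma skew_der_scale: "skew_der C k (scale c x) = scale c (skew_der C k x)"
  by (rule Modules.module_hom.scale[OF skew_der_hom])

lemma skew_der_sum: "skew_der C k (\<Sum>a\<in>A. f a) = (\<Sum>a\<in>A. skew_der C k (f a))"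
  by (rule Modules.module_hom.sum[OF skew_der_hom])

lemma skew_der_div_pow:
  assumes C: "super_cartan_datum C"
  shows "skew_der C k (div_pow C i r * y) = (if k = i then div_pow_der C i r * y else 0)
    + scale (comm_factor C k i ^ r) (div_pow C i r * skew_der C k y)"
proof (cases r)
  case 0
  then show ?thesis by (simp add: div_pow_0 div_pow_der_def)
next
  case (Suc s)
  show ?thesis
    unfolding Suc div_pow_def div_pow_der_def scale_mult_left skew_der_scale skew_der_gen_power
    by (simp add: free_mod.scale_right_distrib scale_mult_left inverse_qfact_Suc[OF C] mult.commute
        del: sum.lessThan_Suc)
qed

lemma lookup_div_pow_mult: "Poly_Mapping.lookup (div_pow C i r * y) 0 = (if r =
    0 then Poly_Mapping.lookup y 0 else 0)"
proof (cases r)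
  case (Suc s)
  then show ?thesis
    by (simp add: div_pow_def scale_mult_left lookup_scale mult.assoc lookup_gen_mult_zero)
qed (simp add: div_pow_0)

section \<open>The higher Serre elements\<close>

definition serre_coeff :: "'i cartan_data \<Rightarrow> 'i \<Rightarrow> 'i \<Rightarrow> int \<Rightarrow> nat \<Rightarrow> nat \<Rightarrow> nat \<Rightarrow> ratfun_pi" where
  "serre_coeff C i j \<alpha> n m r = (- 1) ^ r * pi_i C i ^ serre_exponent C n r i j *
     (pi_i C i * q_i C i) powi (- (int r * (int n * \<alpha> + int m - 1)))"

text \<open>
  The element \<open>e\<^bsub>i,j;n,m\<^esub>\<close> with \<open>\<theta>\<^sub>i\<close> in place of \<open>E\<^sub>i\<close>; the parameter \<open>\<alpha>\<close> stands for \<open>\<langle>i,j'\<rangle>\<close>.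
\<close>

definition serre_free :: "'i cartan_data \<Rightarrow> 'i \<Rightarrow> 'i \<Rightarrow> int \<Rightarrow> nat \<Rightarrow> nat \<Rightarrow> 'i free_alg" where
  "serre_free C i j \<alpha> n m = (\<Sum>r\<le>m. scale (serre_coeff C i j \<alpha> n m r)
     (div_pow C i r * (div_pow C j n * div_pow C i (m - r))))"

lemma lookup_serre_free: "m > 0 \<Longrightarrow> Poly_Mapping.lookup (serre_free C i j \<alpha> n m) 0 = 0"
  using lookup_div_pow_mult[of C i m 1]
  by (auto simp: serre_free_def lookup_sum lookup_scale lookup_div_pow_mult intro!: sum.neutral)

text \<open>
  Since \<open>i \<cdot> j = d\<^sub>i \<alpha>\<close>, the commutation factor is a power of \<open>q\<^sub>i\<close> up to a power of \<open>\<pi>\<close>.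
\<close>

lemma comm_factor_eq:
  assumes "cdot C i j = dd C i * \<alpha>"
  shows "comm_factor C i j = q_i C i powi \<alpha> * pi_i C i ^ parity C j"
  unfolding comm_factor_def assms unit_powi_mult_int[OF q_elt_unit] q_i_def pi_i_def power_mult ..

lemma pi_i_powi_even:
  assumes "i \<in> odd_part C \<longrightarrow> even \<alpha>"
  shows "pi_i C i powi \<alpha> = 1"
proof (cases "i \<in> odd_part C")
  case True
  then obtain k where "\<alpha> = 2 * k" using assms by blast
  moreover have "pi_i C i powi 2 = 1" by (simp add: power_int_def power2_eq_square pi_i_square)
  moreover have "1 powi k = (1 :: ratfun_pi)" by (simp add: power_int_def inverse_one)
  ultimately show ?thesis using unit_powi_mult_int[OF pi_i_unit[of C i], of 2 k] by simp
next
  case False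
  then show ?thesis by (simp add: pi_i_def parity_def power_int_def inverse_one)
qed

lemma pi_i_power_parity: "pi_i C i ^ (parity C i * k) = pi_i C i ^ k"
  using parity_cases[of C i] by (auto simp: pi_i_def)

lemma pi_i_serre_exponent: "pi_i C i ^ serre_exponent C n r i j =
    pi_i C i ^ (r * n * parity C j + (r choose 2))"
proof -
  have "serre_exponent C n r i j = parity C i * (r * n * parity C j + (r choose 2))"
    by (simp add: serre_exponent_def algebra_simps)
  then show ?thesis by (simp only: pi_i_power_parity)
qed

text \<open>
  Passing \<open>\<theta>\<^sub>i\<^bsup>(r)\<^esup>\<close> to reach \<open>\<theta>\<^sub>j\<^bsup>(n+1)\<^esup>\<close> costs \<open>q\<^sub>i\<^bsup>r\<alpha>\<^esup>\<close> up to a power of \<open>\<pi>\<close>, which is exactly the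
  quotient of the coefficients for \<open>n\<close> and \<open>n + 1\<close>. That quotient contains
  \<open>(\<pi>\<^sub>iq\<^sub>i)\<^bsup>r\<alpha>\<^esup>\<close>, and for odd \<open>i\<close> evenness of \<open>\<alpha>\<close> is what makes the two agree.
\<close>

lemma skew_der_serre_j:
  assumes C: "super_cartan_datum C" and "i \<noteq> j"
    and dot: "cdot C i j = dd C i * \<alpha>" and even: "i \<in> odd_part C \<longrightarrow> even \<alpha>"
  shows "skew_der C j (serre_free C i j \<alpha> (Suc n) m) = scale (q_i C j ^ n) (serre_free C i j \<alpha> n m)"
proof -
  have c: "serre_coeff C i j \<alpha> (Suc n) m r * comm_factor C j i ^ r =
      serre_coeff C i j \<alpha> n m r" for r
  proof -
    let ?p = "pi_i C i" and ?q = "q_i C i"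
    let ?N = "int r * (int n * \<alpha> + int m - 1)"
    have ev: "?p powi (int r * \<alpha>) = 1"
      using even by (intro pi_i_powi_even) simp
    have "comm_factor C j i ^ r = ?q powi (\<alpha> * int r) * ?p ^ (r * parity C j)"
      unfolding comm_factor_sym[OF C, of j i] comm_factor_eq[OF dot] power_mult_distrib
        unit_powi_mult[OF q_i_unit] by (simp add: power_mult[symmetric] mult.commute)
    also have "?q powi (\<alpha> * int r) = (?p * ?q) powi (int r * \<alpha>)"
      unfolding unit_powi_distrib[OF pi_i_unit q_i_unit] ev by (simp add: mult.commute)
    finally have cf: "comm_factor C j i ^ r = (?p * ?q) powi (int r * \<alpha>) * ?p ^ (r * parity C j)" .
    have pp: "?p ^ (r * Suc n * parity C j + (r choose 2)) * ?p ^ (r * parity C j) =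
        ?p ^ (r * n * parity C j + (r choose 2))"
    proof -
      have "?p ^ (r * parity C j) * ?p ^ (r * parity C j) = 1"
        by (simp add: power_mult_distrib[symmetric] pi_i_square)
      moreover have "?p ^ (r * Suc n * parity C j + (r choose 2)) =
          ?p ^ (r * n * parity C j + (r choose 2)) * ?p ^ (r * parity C j)"
        by (simp add: power_add[symmetric] algebra_simps)
      ultimately show ?thesis by (simp add: mult.assoc)
    qed
    have qq: "(?p * ?q) powi (- (int r * (int (Suc n) * \<alpha> +
        int m - 1))) * (?p * ?q) powi (int r * \<alpha>) =
        (?p * ?q) powi (- ?N)"
      unfolding unit_powi_add[OF pi_q_unit, symmetric] by (simp add: algebra_simps)
    have "serre_coeff C i j \<alpha> (Suc n) m r * comm_factor C j i ^ r = (- 1) ^ r *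
       (?p ^ (r * Suc n * parity C j + (r choose 2)) * ?p ^ (r * parity C j)) *
       ((?p * ?q) powi (- (int r * (int (Suc n) * \<alpha> + int m - 1))) * (?p * ?q) powi (int r * \<alpha>))"
      unfolding serre_coeff_def cf pi_i_serre_exponent by (simp only: ac_simps)
    then show ?thesis unfolding pp qq serre_coeff_def pi_i_serre_exponent .
  qed
  have "skew_der C j (div_pow C i r * (div_pow C j (Suc n) * div_pow C i s)) =
     scale (q_i C j ^ n) (scale (comm_factor C j i ^ r) (div_pow C i r * (div_pow C j n *
         div_pow C i s)))" for r s
    using assms(2) skew_der_div_pow[OF C, of j i s 1]
    by (simp add: skew_der_div_pow[OF C] div_pow_der_def scale_mult_left scale_mult_right
        skew_der_one mult.commute)
  then show ?thesis
    unfolding serre_free_def skew_der_sum skew_der_scale free_mod.scale_sum_right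
    by (simp add: c mult.left_commute[of _ "q_i C j ^ n"] mult.assoc)
qed

lemma skew_der_serre_0:
  assumes C: "super_cartan_datum C" and "k \<noteq> i" "k = j \<Longrightarrow> n = 0"
  shows "skew_der C k (serre_free C i j \<alpha> n m) = 0"
proof -
  have "skew_der C k (div_pow C i r * (div_pow C j n * div_pow C i s)) = 0" for r s
    using assms(2,3) skew_der_div_pow[OF C, of k i s 1]
    by (simp add: skew_der_div_pow[OF C] div_pow_der_def skew_der_one)
  then show ?thesis
    unfolding serre_free_def skew_der_sum skew_der_scale by simp
qed

text \<open>
  Each \<open>\<theta>\<^sub>i\<^bsup>(r)\<^esup> \<theta>\<^sub>j\<^bsup>(n)\<^esup> \<theta>\<^sub>i\<^bsup>(m-r)\<^esup>\<close> arises twice: from the left power in the summand \<open>r + 1\<close> and from the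
  right power in the summand \<open>r\<close>. The two coefficients combine to a multiple, independent of \<open>r\<close>, of
  the coefficient for \<open>m\<close>. The multiplier vanishes when \<open>N n m = 0\<close>, and this is why the
  relations start at the exponent \<open>1 - n\<alpha>\<close>.
\<close>

lemma skew_der_serre_i:
  assumes C: "super_cartan_datum C" and "i \<noteq> j"
    and dot: "cdot C i j = dd C i * \<alpha>"
  defines "N \<equiv> \<lambda>n m. int n * \<alpha> + int m"
  shows "skew_der C i (serre_free C i j \<alpha> n (Suc m)) =
    scale (pi_i C i ^ (n * parity C j) * (q_i C i powi N n m - (pi_i C i * q_i C i) powi (- N n m)))
     (serre_free C i j \<alpha> n m)"
proof -
  let ?p = "pi_i C i" and ?q = "q_i C i"
  let ?M = "N n m"
  let ?\<kappa> = "?p ^ (n * parity C j) * (?q powi ?M - (?p * ?q) powi (- ?M))"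
  let ?c = "serre_coeff C i j \<alpha> n (Suc m)"
  let ?t = "\<lambda>r. div_pow C i r * (div_pow C j n * div_pow C i (m - r))"
  define x where "x = comm_factor C i i"
  define y where "y = comm_factor C i j ^ n"
  have coeff: "?c (Suc r) * ?q ^ r + ?c r * (x ^ r * y * ?q ^ (m - r)) =
      ?\<kappa> * serre_coeff C i j \<alpha> n m r"
    if "r \<le> m" for r
  proof -
    \<comment> \<open>The coefficients with index \<open>r\<close> and \<open>r + 1\<close> for \<open>Suc m\<close>, and the one with index \<open>r\<close> for \<open>m\<close>,
      are all equal to \<open>P\<close> up to sign and powers of \<open>\<pi>\<^sub>i\<close> and \<open>q\<^sub>i\<close>.\<close>
    define P where "P = (- 1) ^ r * ?p ^ (r * n * parity C j +
        (r choose 2)) * (?p * ?q) powi (- (int r * ?M))"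
    have c0: "?c r = P"
      by (simp add: P_def serre_coeff_def pi_i_serre_exponent N_def)
    have c1: "?c (Suc r) = - (P * ?p ^ (n * parity C j) * ?p ^ r * (?p * ?q) powi (- ?M))"
    proof -
      have "(?p * ?q) powi (- (int (Suc r) * ?M)) = (?p * ?q) powi (- (int r * ?M)) * (?p *
          ?q) powi (- ?M)"
        unfolding unit_powi_add[OF pi_q_unit, symmetric] by (simp add: algebra_simps)
      moreover have "?p ^ (Suc r * n * parity C j + (Suc r choose 2)) =
          ?p ^ (r * n * parity C j + (r choose 2)) * ?p ^ (n * parity C j) * ?p ^ r"
        unfolding power_add[symmetric] by (simp add: algebra_simps numeral_2_eq_2)
      moreover have "?c (Suc r) = (- 1) ^ Suc r * ?p ^ (Suc r * n * parity C j + (Suc r choose 2))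
          * (?p * ?q) powi (- (int (Suc r) * ?M))"
        by (simp only: serre_coeff_def pi_i_serre_exponent N_def) (simp add: algebra_simps)
      ultimately show ?thesis by (simp only: P_def power_Suc ac_simps mult_minus_left
          mult_minus_right mult_1_left)
    qed
    have c2: "serre_coeff C i j \<alpha> n m r = P * (?p * ?q) ^ r"
    proof -
      have "(?p * ?q) powi (- (int r * (?M - 1))) = (?p * ?q) powi (- (int r * ?M)) * (?p *
          ?q) powi (int r)"
        unfolding unit_powi_add[OF pi_q_unit, symmetric] by (simp add: algebra_simps)
      then show ?thesis by (simp add: P_def serre_coeff_def pi_i_serre_exponent N_def)
    qed
    have "x ^ r * y * ?q ^ (m - r) = ?p ^ r * ?p ^ (n * parity C j) *
        (?q powi (2 * int r) * ?q powi (\<alpha> * int n) * ?q powi (int (m - r)))"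
    proof -
      have "x ^ r = ?p ^ r * ?q powi (2 * int r)"
        unfolding x_def comm_factor_self[OF C] power_mult_distrib
        using unit_powi_mult[OF q_i_unit, of C i 2 r] by simp
      moreover have "y = ?q powi (\<alpha> * int n) * ?p ^ (n * parity C j)"
        unfolding y_def comm_factor_eq[OF dot] power_mult_distrib unit_powi_mult[OF q_i_unit]
        by (simp add: power_mult[symmetric] mult.commute)
      ultimately show ?thesis by (simp add: ac_simps)
    qed
    also have "?q powi (2 * int r) * ?q powi (\<alpha> * int n) * ?q powi (int (m - r)) =
        ?q powi (int r) * ?q powi ?M"
      unfolding unit_powi_add[OF q_i_unit, symmetric] using that
          by (simp add: N_def of_nat_diff algebra_simps)
    finally have "x ^ r * y * ?q ^ (m - r) = ?p ^ r * ?p ^ (n * parity C j) * (?q ^ r * ?q powi ?M)"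
      by simp
    then show ?thesis
      unfolding c0 c1 c2 by (simp add: power_mult_distrib right_diff_distrib left_diff_distrib)
  qed
  have der: "skew_der C i (div_pow C i r * (div_pow C j n * div_pow C i s)) =
     div_pow_der C i r * (div_pow C j n * div_pow C i s)
     + scale (x ^ r * y) (div_pow C i r * (div_pow C j n * div_pow_der C i s))" for r s
    using assms(2) skew_der_div_pow[OF C, of i i s 1] unfolding x_def y_def
    by (simp add: skew_der_div_pow[OF C] skew_der_one scale_mult_right)
  have "skew_der C i (serre_free C i j \<alpha> n (Suc m)) =
      (\<Sum>r\<le>Suc m. scale (?c r) (div_pow_der C i r * (div_pow C j n * div_pow C i (Suc m - r))))
    + (\<Sum>r\<le>Suc m. scale (?c r * (x ^ r * y)) (div_pow C i r * (div_pow C j n *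
        div_pow_der C i (Suc m - r))))"
    unfolding serre_free_def skew_der_sum skew_der_scale der free_mod.scale_right_distrib
        sum.distrib
    by simp
  also have "(\<Sum>r\<le>Suc m. scale (?c r) (div_pow_der C i r * (div_pow C j n *
      div_pow C i (Suc m - r))))
      = (\<Sum>r\<le>m. scale (?c (Suc r) * ?q ^ r) (?t r))"
    by (subst sum.atMost_Suc_shift) (simp add: div_pow_der_def scale_mult_left)
  also have "(\<Sum>r\<le>Suc m. scale (?c r * (x ^ r * y)) (div_pow C i r * (div_pow C j n *
      div_pow_der C i (Suc m - r))))
      = (\<Sum>r\<le>m. scale (?c r * (x ^ r * y * ?q ^ (m - r))) (?t r))"
    by (auto intro!: sum.cong simp: div_pow_der_def scale_mult_right Suc_diff_le mult.assoc)
  also have "(\<Sum>r\<le>m. scale (?c (Suc r) * ?q ^ r) (?t r)) +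
      (\<Sum>r\<le>m. scale (?c r * (x ^ r * y * ?q ^ (m - r))) (?t r))
     = (\<Sum>r\<le>m. scale (?\<kappa> * serre_coeff C i j \<alpha> n m r) (?t r))"
    unfolding sum.distrib[symmetric] free_mod.scale_left_distrib[symmetric]
    by (intro sum.cong refl) (simp only: atMost_iff coeff)
  also have "\<dots> = scale ?\<kappa> (serre_free C i j \<alpha> n m)"
    by (simp add: serre_free_def free_mod.scale_sum_right)
  finally show ?thesis .
qed

text \<open>
  Induction on \<open>n + m\<close>. The derivation along \<open>j\<close> lowers \<open>n\<close>, which preserves the inequality
  because \<open>\<alpha> \<le> 0\<close>. The derivation along \<open>i\<close> lowers \<open>m\<close>; this violates the inequality only in the
  boundary case, where its multiplier is zero. The inequality forces \<open>m > 0\<close>, so there is no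
  constant term.
\<close>

lemma serre_free_in_radical:
  assumes C: "super_cartan_datum C" and ij: "i \<noteq> j"
    and dot: "cdot C i j = dd C i * \<alpha>" and even: "i \<in> odd_part C \<longrightarrow> even \<alpha>"
    and neg: "\<alpha> \<le> 0" and m: "int m > - int n * \<alpha>"
  shows "serre_free C i j \<alpha> n m \<in> form_radical C"
  using m
proof (induction "n + m" arbitrary: n m rule: less_induct)
  case less
  have "int n * \<alpha> \<le> 0" using neg by (simp add: mult_nonneg_nonpos)
  with less.prems obtain m' where m': "m = Suc m'" by (cases m) auto
  show ?case
  proof (rule in_radicalI[OF C])
    show "Poly_Mapping.lookup (serre_free C i j \<alpha> n m) 0 = 0"
      by (rule lookup_serre_free) (simp add: m')
    fix k
    consider "k = i" | n' where "k = j" "n = Suc n'" | "k \<noteq> i" "k = j \<Longrightarrow> n = 0"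
      using not0_implies_Suc by blast
    then show "skew_der C k (serre_free C i j \<alpha> n m) \<in> form_radical C"
    proof cases
      case 1
      show ?thesis
      proof (cases "int n * \<alpha> + int m' = 0")
        case True
        then show ?thesis
          unfolding 1 m' skew_der_serre_i[OF C ij dot] by (simp add: radical_zero[OF C])
      next
        case False
        then have "int m' > - int n * \<alpha>" using less.prems by (simp add: m')
        then have "serre_free C i j \<alpha> n m' \<in> form_radical C"
          using less.hyps[of n m'] by (simp add: m')
        then show ?thesis
          unfolding 1 m' skew_der_serre_i[OF C ij dot] by (rule radical_scale[OF C])
      qed
    next
      case (2 n')
      have "int m > - int n' * \<alpha>" using less.prems neg by (simp add: 2 algebra_simps)
      then have "serre_free C i j \<alpha> n' m \<in> form_radical C"
        using less.hyps[of n' m] by (simp add: 2)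
      then show ?thesis
        unfolding 2 skew_der_serre_j[OF C ij dot even] by (rule radical_scale[OF C])
    next
      case 3
      then show ?thesis by (simp add: skew_der_serre_0[OF C] radical_zero[OF C])
    qed
  qed
qed

section \<open>Passage to the quantum covering group\<close>

lemma subst_alg_eq_lin: "subst_alg g x = lin scale (\<lambda>w. prod_list (map g (letters w))) x"
  by (simp add: subst_alg_def lin_def)

lemma subst_alg_hom: "linear_map (subst_alg g)"
  unfolding subst_alg_eq_lin[abs_def] by (rule lin_free_hom)

lemma subst_alg_basis: "subst_alg g (basis_word w) = prod_list (map g w)"
  by (simp add: subst_alg_eq_lin lin_free_single)

lemma subst_alg_gen: "subst_alg g (gen i) = g i"
  using subst_alg_basis[of g "[i]"] by (simp add: gen_def)

lemma subst_alg_one: "subst_alg g 1 = 1"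
  using subst_alg_basis[of g "[]"] by (simp add: basis_word_Nil)

lemma subst_alg_mult: "subst_alg g (x * y) = subst_alg g x * subst_alg g y"
proof -
  have "subst_alg g (basis_word u * y) = subst_alg g (basis_word u) * subst_alg g y" for u
    by (rule hom_eq_on_words[where s = scale and x = y])
      (intro hom_comp[OF subst_alg_hom] homs subst_alg_hom | simp add: basis_word_mult
          subst_alg_basis)+
  then show ?thesis
    by (intro hom_eq_on_words[where s = scale and x = x and f = "\<lambda>x. subst_alg g (x * y)"
         and g = "\<lambda>x. subst_alg g x * subst_alg g y"] hom_comp[OF subst_alg_hom] homs subst_alg_hom)
qed

lemma subst_alg_power: "subst_alg g (x ^ n) = subst_alg g x ^ n"
  by (induction n) (simp_all add: subst_alg_one subst_alg_mult)

abbreviation free_ring :: "'a free_alg ring" where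
  "free_ring \<equiv> ring_of_type_algebra"

lemma free_ring_simps: "carrier free_ring = UNIV" "x \<otimes>\<^bsub>free_ring\<^esub> y = x * y"
  "x \<oplus>\<^bsub>free_ring\<^esub> y = x + y" "\<one>\<^bsub>free_ring\<^esub> = 1" "\<zero>\<^bsub>free_ring\<^esub> = 0"
  by (simp_all add: ring_of_type_algebra_def)

lemma free_ring_ring: "ring (free_ring :: 'a free_alg ring)"
proof (rule ringI)
  show "abelian_group (free_ring :: 'a free_alg ring)"
    by (rule abelian_groupI) (auto simp: free_ring_simps algebra_simps intro: exI[of _ "- _"]
        left_minus)
  show "monoid (free_ring :: 'a free_alg ring)"
    by (rule monoidI) (simp_all add: free_ring_simps mult.assoc)
qed (simp_all add: free_ring_simps distrib_left distrib_right)

lemma U_ideal_ideal: "ideal (U_ideal C R) free_ring"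
  unfolding U_ideal_def by (rule ring.genideal_ideal[OF free_ring_ring]) (simp add: free_ring_simps)

lemma U_class_hom: "ring_hom_ring free_ring (U_alg C R) (U_class C R)"
  unfolding U_alg_def U_class_def by (rule ideal.rcos_ring_hom_ring[OF U_ideal_ideal])

lemma U_class_mult: "U_class C R x \<otimes>\<^bsub>U_alg C R\<^esub> U_class C R y = U_class C R (x * y)"
  using ring_hom_mult[OF ring_hom_ring.homh[OF U_class_hom], of x y C R]
      by (simp add: free_ring_simps)

lemma U_class_power: "U_class C R x [^]\<^bsub>U_alg C R\<^esub> (n :: nat) = U_class C R (x ^ n)"
proof (induction n)
  case 0
  then show ?case using ring_hom_one[OF ring_hom_ring.homh[OF U_class_hom], of C R]
    by (simp add: free_ring_simps)
next
  case (Suc n)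
  then show ?case by (simp add: U_class_mult power_commutes)
qed

lemma U_class_scale: "U_scale C R c (U_class C R x) = U_class C R (scale c x)"
  by (simp add: U_scale_def U_class_mult scale_mult_left)

lemma E_div_eq: "E_div C R i n = U_class C R (subst_alg (\<lambda>i. fE i) (div_pow C i n))"
  by (simp add: E_div_def U_class_power U_class_scale div_pow_def Modules.module_hom.scale[OF
      subst_alg_hom]
      subst_alg_power subst_alg_gen)

lemma U_class_sum:
  assumes "finite A"
  shows "finsum (U_alg C R) (\<lambda>a. U_class C R (f a)) A = U_class C R (\<Sum>a\<in>A. f a)"
proof -
  interpret free: ring free_ring by (rule free_ring_ring)
  interpret hom: ring_hom_ring free_ring "U_alg C R" "U_class C R" by (rule U_class_hom)
  have "finsum free_ring f A = (\<Sum>a\<in>A. f a)"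
    using assms by (induction A) (simp_all add: free_ring_simps)
  then show ?thesis
    using hom.hom_finsum[of f A] by (simp add: free_ring_simps comp_def)
qed

lemma U_class_radical:
  assumes "x \<in> form_radical C"
  shows "U_class C R (subst_alg (\<lambda>i. fE i) x) = \<zero>\<^bsub>U_alg C R\<^esub>"
proof -
  interpret ideal "U_ideal C R" free_ring by (rule U_ideal_ideal)
  have "subst_alg (\<lambda>i. fE i) x - 0 \<in> {a - b | a b. U_relation C R a b}"
    using Serre_E[OF assms] by blast
  then have "subst_alg (\<lambda>i. fE i) x \<in> U_ideal C R"
    unfolding U_ideal_def using genideal_self[of "{a - b | a b. U_relation C R a b}"]
    by (auto simp: free_ring_simps)
  then show ?thesis
    unfolding U_class_def U_alg_def FactRing_def by (simp add: a_rcos_const)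
qed

lemma serre_elt_eq:
  "serre_elt C R i j n m = U_class C R (subst_alg (\<lambda>i. fE i)
     (serre_free C i j (pairing R (simple_coroot R i) (simple_root R j)) n m))"
proof -
  let ?\<alpha> = "pairing R (simple_coroot R i) (simple_root R j)"
  let ?S = "{(r, s). r + s = m}"
  let ?f = "\<lambda>(r, s). scale (serre_coeff C i j ?\<alpha> n m r) (div_pow C i r * (div_pow C j n *
      div_pow C i s))"
  have img: "?S = (\<lambda>r. (r, m - r)) ` {..m}" by force
  then have fin: "finite ?S" by simp
  have "serre_elt C R i j n m = finsum (U_alg C R) (\<lambda>a. U_class C R (subst_alg (\<lambda>i. fE i) (?f
      a))) ?S"
    unfolding serre_elt_def
    by (simp add: case_prod_unfold E_div_eq U_class_mult U_class_scale subst_alg_mult mult.assoc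
       Modules.module_hom.scale[OF subst_alg_hom] serre_coeff_def)
  also have "\<dots> = U_class C R (subst_alg (\<lambda>i. fE i) (\<Sum>a\<in>?S. ?f a))"
    by (simp add: U_class_sum[OF fin] Modules.module_hom.sum[OF subst_alg_hom])
  also have "(\<Sum>a\<in>?S. ?f a) = serre_free C i j ?\<alpha> n m"
    unfolding img serre_free_def by (subst sum.reindex) (auto intro!: inj_onI)
  finally show ?thesis .
qed

theorem proposition4p2p4:
  fixes C :: "'i::finite cartan_data"
    and R :: "('i, 'y::ab_group_add, 'x::ab_group_add) root_data"
    and i j :: 'i
    and n m :: nat
  assumes "super_cartan_datum C"
    and "root_datum C R"
    and "i \<noteq> j"
    and "int m > - int n * pairing R (simple_coroot R i) (simple_root R j)"
  shows "serre_elt C R i j n m = \<zero>\<^bsub>U_alg C R\<^esub>"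
proof -
  define \<alpha> where "\<alpha> = pairing R (simple_coroot R i) (simple_root R j)"
  have "even (cdot C i i)" and dd_pos: "cdot C i i div 2 > 0"
    and nat_ex: "\<exists>k::nat. 2 * cdot C i j = - int k * cdot C i i"
    and int_ex: "i \<in> odd_part C \<Longrightarrow> \<exists>k::int. 2 * cdot C i j = (2 * k) * cdot C i i"
    using assms(1,3) unfolding super_cartan_datum_def by blast+
  then have dd: "cdot C i i = 2 * dd C i" and pos: "cdot C i i > 0"
    by (simp_all add: dd_def)
  have \<alpha>: "\<alpha> * cdot C i i = 2 * cdot C i j"
    using assms(2) by (simp add: root_datum_def \<alpha>_def)
  then have dot: "cdot C i j = dd C i * \<alpha>" by (simp add: dd mult.commute)
  obtain k :: nat where "2 * cdot C i j = - int k * cdot C i i"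
    using nat_ex by blast
  then have "\<alpha> * cdot C i i = - int k * cdot C i i" using \<alpha> by simp
  then have "\<alpha> = - int k" using pos by (simp only: mult_cancel_right) simp
  then have neg: "\<alpha> \<le> 0" by simp
  have even: "i \<in> odd_part C \<longrightarrow> even \<alpha>"
  proof
    assume "i \<in> odd_part C"
    then obtain k :: int where "2 * cdot C i j = (2 * k) * cdot C i i"
      using int_ex by blast
    then have "\<alpha> * cdot C i i = (2 * k) * cdot C i i" using \<alpha> by simp
    then have "\<alpha> = 2 * k" using pos by (simp only: mult_cancel_right) simp
    then show "even \<alpha>" by simp
  qed
  have "serre_free C i j \<alpha> n m \<in> form_radical C"
    using serre_free_in_radical[OF assms(1,3) dot even neg] assms(4) by (simp add: \<alpha>_def)
  then show ?thesis
    unfolding serre_elt_eq \<alpha>_def[symmetric] by (rule U_class_radical)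
qed

end
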